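(* Let $X$ and $Y$ be complex Banach spaces, $A\in\mathcal{B}(X)$, $B\in\mathcal{B}(Y)$. If $A$, $A^*$, $B$ and $B^*$ have the SVEP, then for every $C\in\mathcal{B}(Y,X)$, $$\sigma_{gK}(M_C)=\sigma_{gK}(A)\cup\sigma_{gK}(B),$$ where $M_C=\begin{pmatrix}A & C\\ 0 & B\end{pmatrix}\in\mathcal{B}(X\oplus Y)$.
   Context: $\mathcal{B}(X)$ is the algebra of bounded linear operators on $X$, and $\mathcal{B}(Y,X)$ the space of bounded linear operators from $Y$ to $X$. $M_C$ acts on $X\oplus Y$ by $M_C(x,y)=(Ax+Cy,By)$. $T^*$ denotes the adjoint of $T$ (acting on the dual space); $N(T)$, $R(T)$ are the null space and range, and $R^{\infty}(T)=\bigcap_{n\ge 0}R(T^n)$. A bounded operator $T$ on a Banach space $Z$ is semi-regular (Kato) if $R(T)$ is closed and $N(T)\subseteq R^\infty(T)$. $T$ is Pseudo-Fredholm (admits a generalized Kato decomposition) if there are $T$-invariant closed subspaces $M,N$ with $Z=M\oplus N$, $T|_M$ semi-regular and $T|_N$ quasinilpotent (here $M=\{0\}$ or $N=\{0\}$ is allowed). $\sigma_{gK}(T)=\{\lambda\in\mathbb{C}: T-\lambda I \text{ is not Pseudo-Fredholm}\}$. $T$ has the single-valued extension property (SVEP) at $\lambda_0\in\mathbb{C}$ if for every open neighbourhood $U\subseteq\mathbb{C}$ of $\lambda_0$, the only analytic function $f:U\to Z$ with $(T-zI)f(z)=0$ for all $z\in U$ is $f\equiv 0$. $T$ has the SVEP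 if it has the SVEP at every $\lambda\in\mathbb{C}$. *)

theory Defs
  imports "HOL-Analysis.Analysis"
begin

section \<open>Complex Banach spaces\<close>

class complex_normed_vector = real_normed_vector +
  fixes scaleC :: "complex \<Rightarrow> 'a \<Rightarrow> 'a"  (infixr "*\<^sub>C" 75)
  assumes scaleC_add_right: "c *\<^sub>C (x + y) = c *\<^sub>C x + c *\<^sub>C y"
    and scaleC_add_left: "(c + d) *\<^sub>C x = c *\<^sub>C x + d *\<^sub>C x"
    and scaleC_scaleC: "c *\<^sub>C (d *\<^sub>C x) = (c * d) *\<^sub>C x"
    and scaleC_of_real: "complex_of_real r *\<^sub>C x = r *\<^sub>R x"
    and norm_scaleC: "norm (c *\<^sub>C x) = cmod c * norm x"

lemma scaleC_one [simp]: "1 *\<^sub>C x = (x::'a::complex_normed_vector)"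
  using scaleC_of_real[of 1 x] by simp

class complex_banach = complex_normed_vector + banach

global_interpretation complex_vector:
  vector_space "scaleC :: complex \<Rightarrow> 'a \<Rightarrow> 'a::complex_normed_vector"
  by standard (simp_all add: scaleC_add_right scaleC_add_left scaleC_scaleC)

instantiation complex :: complex_banach
begin

definition scaleC_complex :: "complex \<Rightarrow> complex \<Rightarrow> complex" where
  "scaleC_complex c x = c * x"

instance
  by standard
    (simp_all add: scaleC_complex_def algebra_simps scaleR_conv_of_real norm_mult)

end

text \<open>
  The direct sum of two spaces is the product type with the library norm
  \<^term>\<open>sqrt ((norm x)\<^sup>2 + (norm y)\<^sup>2)\<close>.
\<close>

instantiation prod :: (complex_normed_vector, complex_normed_vector) complex_normed_vector
begin

definition scaleC_prod :: "complex \<Rightarrow> 'a \<times> 'b \<Rightarrow> 'a \<times> 'b" where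
  "scaleC_prod c p = (c *\<^sub>C fst p, c *\<^sub>C snd p)"

instance
proof
  fix c d :: complex and r :: real and x y :: "'a \<times> 'b"
  show "c *\<^sub>C (x + y) = c *\<^sub>C x + c *\<^sub>C y"
    by (simp add: scaleC_prod_def scaleC_add_right)
  show "(c + d) *\<^sub>C x = c *\<^sub>C x + d *\<^sub>C x"
    by (simp add: scaleC_prod_def scaleC_add_left)
  show "c *\<^sub>C (d *\<^sub>C x) = (c * d) *\<^sub>C x"
    by (simp add: scaleC_prod_def scaleC_scaleC)
  show "complex_of_real r *\<^sub>C x = r *\<^sub>R x"
    by (simp add: scaleC_prod_def scaleC_of_real prod_eq_iff)
  have "norm (c *\<^sub>C x) = sqrt ((cmod c)\<^sup>2 * ((norm (fst x))\<^sup>2 + (norm (snd x))\<^sup>2))"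
    by (simp add: scaleC_prod_def norm_prod_def norm_scaleC power_mult_distrib distrib_left)
  then show "norm (c *\<^sub>C x) = cmod c * norm x"
    by (simp add: norm_prod_def real_sqrt_mult)
qed

end

instance prod :: (complex_banach, complex_banach) complex_banach ..

section \<open>Bounded complex-linear operators\<close>

definition bounded_clinear ::
    "('a::complex_normed_vector \<Rightarrow> 'b::complex_normed_vector) \<Rightarrow> bool" where
  "bounded_clinear f \<longleftrightarrow>
     Vector_Spaces.linear scaleC scaleC f \<and> (\<exists>K. \<forall>x. norm (f x) \<le> norm x * K)"

lemma bounded_clinear_iff:
  "bounded_clinear f \<longleftrightarrow> bounded_linear f \<and> (\<forall>c x. f (c *\<^sub>C x) = c *\<^sub>C f x)"
proof
  assume f: "bounded_clinear f"
  then interpret L: Vector_Spaces.linear scaleC scaleC f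
    by (simp add: bounded_clinear_def)
  obtain K where K: "\<And>x. norm (f x) \<le> norm x * K"
    using f by (auto simp: bounded_clinear_def)
  have "bounded_linear f"
    by (rule bounded_linear_intro[OF L.add _ K])
       (metis L.scale scaleC_of_real)
  then show "bounded_linear f \<and> (\<forall>c x. f (c *\<^sub>C x) = c *\<^sub>C f x)"
    by (simp add: L.scale)
next
  assume f: "bounded_linear f \<and> (\<forall>c x. f (c *\<^sub>C x) = c *\<^sub>C f x)"
  then interpret bounded_linear f by blast
  have "Vector_Spaces.linear scaleC scaleC f"
    using f by unfold_locales (simp_all add: add)
  then show "bounded_clinear f"
    using bounded by (auto simp: bounded_clinear_def)
qed

lemma bounded_clinearI:
  assumes "bounded_linear f" "\<And>c x. f (c *\<^sub>C x) = c *\<^sub>C f x"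
  shows "bounded_clinear f"
  using assms by (simp add: bounded_clinear_iff)

lemma bounded_clinear_zero: "bounded_clinear (\<lambda>_. 0)"
  by (rule bounded_clinearI) simp_all

typedef (overloaded) ('a, 'b) cblinfun  ("(_ \<Rightarrow>\<^sub>C\<^sub>L /_)" [22, 21] 21) =
    "{f :: 'a::complex_normed_vector \<Rightarrow> 'b::complex_normed_vector. bounded_clinear f}"
  morphisms cblinfun_apply CBlinfun
  using bounded_clinear_zero by blast

declare [[coercion cblinfun_apply]]

setup_lifting type_definition_cblinfun

lemma cblinfun_apply_bounded_clinear: "bounded_clinear (cblinfun_apply T)"
  using cblinfun_apply[of T] by simp

lemma cblinfun_apply_bounded_linear: "bounded_linear (cblinfun_apply T)"
  using cblinfun_apply_bounded_clinear[of T] by (simp add: bounded_clinear_iff)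

lemma cblinfun_apply_scaleC: "cblinfun_apply T (c *\<^sub>C x) = c *\<^sub>C cblinfun_apply T x"
  using cblinfun_apply_bounded_clinear[of T] by (simp add: bounded_clinear_iff)

lemma cblinfun_eqI: "(\<And>x. cblinfun_apply S x = cblinfun_apply T x) \<Longrightarrow> S = T"
  by (metis cblinfun_apply_inject ext)

instantiation cblinfun :: (complex_normed_vector, complex_normed_vector) complex_normed_vector
begin

lift_definition zero_cblinfun :: "'a \<Rightarrow>\<^sub>C\<^sub>L 'b" is "\<lambda>_. 0"
  by (rule bounded_clinear_zero)

lift_definition plus_cblinfun :: "('a \<Rightarrow>\<^sub>C\<^sub>L 'b) \<Rightarrow> ('a \<Rightarrow>\<^sub>C\<^sub>L 'b) \<Rightarrow> ('a \<Rightarrow>\<^sub>C\<^sub>L 'b)"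
  is "\<lambda>S T x. S x + T x"
  by (simp add: bounded_clinear_iff bounded_linear_add scaleC_add_right)

lift_definition minus_cblinfun :: "('a \<Rightarrow>\<^sub>C\<^sub>L 'b) \<Rightarrow> ('a \<Rightarrow>\<^sub>C\<^sub>L 'b) \<Rightarrow> ('a \<Rightarrow>\<^sub>C\<^sub>L 'b)"
  is "\<lambda>S T x. S x - T x"
  by (simp add: bounded_clinear_iff bounded_linear_sub complex_vector.scale_right_diff_distrib)

lift_definition uminus_cblinfun :: "('a \<Rightarrow>\<^sub>C\<^sub>L 'b) \<Rightarrow> ('a \<Rightarrow>\<^sub>C\<^sub>L 'b)"
  is "\<lambda>T x. - T x"
  by (simp add: bounded_clinear_iff bounded_linear_minus)

lift_definition scaleC_cblinfun :: "complex \<Rightarrow> ('a \<Rightarrow>\<^sub>C\<^sub>L 'b) \<Rightarrow> ('a \<Rightarrow>\<^sub>C\<^sub>L 'b)"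
  is "\<lambda>c T x. c *\<^sub>C T x"
proof -
  fix c :: complex and T :: "'a \<Rightarrow> 'b"
  assume T: "bounded_clinear T"
  have "bounded_linear (\<lambda>y::'b. c *\<^sub>C y)"
    by (rule bounded_linear_intro[where K = "cmod c"])
       (simp_all add: scaleC_add_right scaleC_scaleC norm_scaleC mult.commute
         flip: scaleC_of_real)
  then have "bounded_linear (\<lambda>x. c *\<^sub>C T x)"
    using T by (auto simp: bounded_clinear_iff intro: bounded_linear_compose)
  then show "bounded_clinear (\<lambda>x. c *\<^sub>C T x)"
    using T by (simp add: bounded_clinear_iff scaleC_scaleC mult.commute)
qed

definition scaleR_cblinfun :: "real \<Rightarrow> ('a \<Rightarrow>\<^sub>C\<^sub>L 'b) \<Rightarrow> ('a \<Rightarrow>\<^sub>C\<^sub>L 'b)" where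
  "scaleR_cblinfun r T = complex_of_real r *\<^sub>C T"

lift_definition norm_cblinfun :: "('a \<Rightarrow>\<^sub>C\<^sub>L 'b) \<Rightarrow> real" is onorm .

definition sgn_cblinfun :: "('a \<Rightarrow>\<^sub>C\<^sub>L 'b) \<Rightarrow> ('a \<Rightarrow>\<^sub>C\<^sub>L 'b)" where
  "sgn_cblinfun T = scaleR (inverse (norm T)) T"

definition dist_cblinfun :: "('a \<Rightarrow>\<^sub>C\<^sub>L 'b) \<Rightarrow> ('a \<Rightarrow>\<^sub>C\<^sub>L 'b) \<Rightarrow> real" where
  "dist_cblinfun S T = norm (S - T)"

definition uniformity_cblinfun :: "(('a \<Rightarrow>\<^sub>C\<^sub>L 'b) \<times> ('a \<Rightarrow>\<^sub>C\<^sub>L 'b)) filter" where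
  "uniformity_cblinfun = (INF e\<in>{0 <..}. principal {(x, y). dist x y < e})"

definition open_cblinfun :: "('a \<Rightarrow>\<^sub>C\<^sub>L 'b) set \<Rightarrow> bool" where
  "open_cblinfun U = (\<forall>x\<in>U. \<forall>\<^sub>F (x', y) in uniformity. x' = x \<longrightarrow> y \<in> U)"

instance
proof
  fix S T R :: "'a \<Rightarrow>\<^sub>C\<^sub>L 'b" and r s :: real and c d :: complex and U :: "('a \<Rightarrow>\<^sub>C\<^sub>L 'b) set"
  show "dist S T = norm (S - T)" by (fact dist_cblinfun_def)
  show "sgn T = inverse (norm T) *\<^sub>R T" by (fact sgn_cblinfun_def)
  show "uniformity = (INF e\<in>{0 <..}. principal {(x, y :: 'a \<Rightarrow>\<^sub>C\<^sub>L 'b). dist x y < e})"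
    by (fact uniformity_cblinfun_def)
  show "open U = (\<forall>x\<in>U. \<forall>\<^sub>F (x', y) in uniformity. x' = x \<longrightarrow> y \<in> U)"
    by (fact open_cblinfun_def)
  show "S + T + R = S + (T + R)" "S + T = T + S" "0 + S = S" "- S + S = 0" "S - T = S + - T"
    by (transfer; simp add: algebra_simps)+
  show scC: "c *\<^sub>C (S + T) = c *\<^sub>C S + c *\<^sub>C T" "(c + d) *\<^sub>C S = c *\<^sub>C S + d *\<^sub>C S"
      "c *\<^sub>C d *\<^sub>C S = (c * d) *\<^sub>C S" for c d and S T :: "'a \<Rightarrow>\<^sub>C\<^sub>L 'b"
    by (transfer; simp add: scaleC_add_right scaleC_add_left scaleC_scaleC)+
  show "complex_of_real r *\<^sub>C T = r *\<^sub>R T" by (simp add: scaleR_cblinfun_def)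
  show "r *\<^sub>R (S + T) = r *\<^sub>R S + r *\<^sub>R T" "(r + s) *\<^sub>R T = r *\<^sub>R T + s *\<^sub>R T"
      "r *\<^sub>R s *\<^sub>R T = (r * s) *\<^sub>R T"
    by (simp_all add: scaleR_cblinfun_def scC)
  show "1 *\<^sub>R T = T"
    unfolding scaleR_cblinfun_def by transfer simp
  show "norm T = 0 \<longleftrightarrow> T = 0"
    by transfer (auto simp: bounded_clinear_iff onorm_eq_0)
  show "norm (S + T) \<le> norm S + norm T"
    by transfer (simp add: bounded_clinear_iff onorm_triangle)
  show nC: "norm (c *\<^sub>C T) = cmod c * norm T" for c
  proof (transfer fixing: c)
    fix T :: "'a \<Rightarrow> 'b"
    assume T: "bounded_clinear T"
    have T': "bounded_linear T" "bounded_linear (\<lambda>x. cmod c *\<^sub>R T x)"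
      using T by (auto simp: bounded_clinear_iff intro: bounded_linear_intros)
    have "onorm (\<lambda>x. c *\<^sub>C T x) = onorm (\<lambda>x. cmod c *\<^sub>R T x)"
      by (simp add: onorm_def norm_scaleC)
    also have "\<dots> = cmod c * onorm T"
      using onorm_scaleR[OF T'(1), of "cmod c"] by simp
    finally show "onorm (\<lambda>x. c *\<^sub>C T x) = cmod c * onorm T" .
  qed
  show "norm (r *\<^sub>R T) = \<bar>r\<bar> * norm T"
    by (simp add: scaleR_cblinfun_def nC)
qed

end

lemma norm_cblinfun: "norm (cblinfun_apply T x) \<le> norm T * norm x"
  by transfer (simp add: bounded_clinear_iff onorm)

instance cblinfun :: (complex_normed_vector, complex_banach) complex_banach
proof
  fix X :: "nat \<Rightarrow> 'a \<Rightarrow>\<^sub>C\<^sub>L 'b"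
  assume X: "Cauchy X"
  define Y where "Y n = Blinfun (cblinfun_apply (X n))" for n
  have Y: "blinfun_apply (Y n) = cblinfun_apply (X n)" for n
    by (simp add: Y_def bounded_linear_Blinfun_apply cblinfun_apply_bounded_linear)
  have "norm (Y m - Y n) = norm (X m - X n)" for m n
    by (simp add: norm_blinfun.rep_eq norm_cblinfun.rep_eq minus_blinfun.rep_eq
        minus_cblinfun.rep_eq Y)
  then have "Cauchy Y"
    using X by (simp add: Cauchy_def dist_norm)
  then obtain L where L: "Y \<longlonglongrightarrow> L"
    by (auto simp: Cauchy_convergent_iff convergent_def)
  have lim: "(\<lambda>n. cblinfun_apply (X n) x) \<longlonglongrightarrow> blinfun_apply L x" for x
    using blinfun.tendsto[OF L tendsto_const, of x] by (simp add: Y)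
  have "blinfun_apply L (c *\<^sub>C x) = c *\<^sub>C blinfun_apply L x" for c x
  proof (rule LIMSEQ_unique[OF lim])
    have "bounded_linear (\<lambda>y::'b. c *\<^sub>C y)"
      by (rule bounded_linear_intro[where K = "cmod c"])
         (simp_all add: scaleC_add_right scaleC_scaleC norm_scaleC mult.commute
           flip: scaleC_of_real)
    from bounded_linear.tendsto[OF this lim[of x]]
    show "(\<lambda>n. cblinfun_apply (X n) (c *\<^sub>C x)) \<longlonglongrightarrow> c *\<^sub>C blinfun_apply L x"
      by (simp add: cblinfun_apply_scaleC)
  qed
  then have cl: "bounded_clinear (blinfun_apply L)"
    by (simp add: bounded_clinear_iff blinfun.bounded_linear_right)
  define M where "M = CBlinfun (blinfun_apply L)"
  have M: "cblinfun_apply M = blinfun_apply L"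
    using cl by (simp add: M_def CBlinfun_inverse)
  have "norm (X n - M) = norm (Y n - L)" for n
    by (simp add: norm_blinfun.rep_eq norm_cblinfun.rep_eq minus_blinfun.rep_eq
        minus_cblinfun.rep_eq Y M)
  then have "X \<longlonglongrightarrow> M"
    using L by (simp add: tendsto_iff dist_norm)
  then show "convergent X" by (auto simp: convergent_def)
qed

lift_definition id_cblinfun :: "'a::complex_normed_vector \<Rightarrow>\<^sub>C\<^sub>L 'a" is "\<lambda>x. x"
  by (rule bounded_clinearI) simp_all

type_synonym 'a cdual = "'a \<Rightarrow>\<^sub>C\<^sub>L complex"

definition adjoint_op ::
    "('a::complex_normed_vector \<Rightarrow>\<^sub>C\<^sub>L 'b::complex_normed_vector) \<Rightarrow> ('b cdual \<Rightarrow>\<^sub>C\<^sub>L 'a cdual)"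
  where "adjoint_op T = CBlinfun (\<lambda>\<phi> :: 'b cdual. CBlinfun (\<lambda>x. \<phi> (T x)))"

lemma adjoint_op_apply:
  fixes T :: "'a::complex_normed_vector \<Rightarrow>\<^sub>C\<^sub>L 'b::complex_normed_vector"
  shows "cblinfun_apply (cblinfun_apply (adjoint_op T) \<phi>) x =
    cblinfun_apply \<phi> (cblinfun_apply T x)"
proof -
  have "bounded_clinear (\<lambda>x. cblinfun_apply \<phi> (T x))" for \<phi> :: "'b cdual"
    by (intro bounded_clinearI bounded_linear_compose[OF cblinfun_apply_bounded_linear]
        cblinfun_apply_bounded_linear) (simp add: cblinfun_apply_scaleC)
  then have app: "cblinfun_apply (CBlinfun (\<lambda>x. cblinfun_apply \<phi> (T x))) =
      (\<lambda>x. cblinfun_apply \<phi> (T x))" for \<phi> :: "'b cdual"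
    by (simp add: CBlinfun_inverse)
  have "bounded_clinear (\<lambda>\<phi> :: 'b cdual. CBlinfun (\<lambda>x. cblinfun_apply \<phi> (T x)))"
  proof (rule bounded_clinearI)
    show scC: "CBlinfun (\<lambda>x. cblinfun_apply (c *\<^sub>C \<phi>) (T x)) =
        c *\<^sub>C CBlinfun (\<lambda>x. cblinfun_apply \<phi> (T x))" for c and \<phi> :: "'b cdual"
      by (rule cblinfun_eqI) (unfold app, simp add: app scaleC_cblinfun.rep_eq)
    show "bounded_linear (\<lambda>\<phi> :: 'b cdual. CBlinfun (\<lambda>x. cblinfun_apply \<phi> (T x)))"
    proof (rule bounded_linear_intro[where K = "norm T"])
      show "CBlinfun (\<lambda>x. cblinfun_apply (\<phi> + \<psi>) (T x)) =
          CBlinfun (\<lambda>x. cblinfun_apply \<phi> (T x)) + CBlinfun (\<lambda>x. cblinfun_apply \<psi> (T x))"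
        for \<phi> \<psi> :: "'b cdual"
        by (rule cblinfun_eqI) (unfold app, simp add: app plus_cblinfun.rep_eq)
      show "CBlinfun (\<lambda>x. cblinfun_apply (r *\<^sub>R \<phi>) (T x)) =
          r *\<^sub>R CBlinfun (\<lambda>x. cblinfun_apply \<phi> (T x))" for r and \<phi> :: "'b cdual"
        using scC[of "complex_of_real r" \<phi>] by (simp add: scaleC_of_real)
      show "norm (CBlinfun (\<lambda>x. cblinfun_apply \<phi> (T x))) \<le> norm \<phi> * norm T"
        for \<phi> :: "'b cdual"
        using onorm_compose[OF cblinfun_apply_bounded_linear[of \<phi>]
            cblinfun_apply_bounded_linear[of T]]
        by (simp add: norm_cblinfun.rep_eq app o_def)
    qed
  qed
  then show ?thesis
    by (simp add: adjoint_op_def CBlinfun_inverse app)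
qed

definition upper_triangular_op ::
    "('a::complex_normed_vector \<Rightarrow>\<^sub>C\<^sub>L 'a) \<Rightarrow> ('b::complex_normed_vector \<Rightarrow>\<^sub>C\<^sub>L 'a) \<Rightarrow>
      ('b \<Rightarrow>\<^sub>C\<^sub>L 'b) \<Rightarrow> (('a \<times> 'b) \<Rightarrow>\<^sub>C\<^sub>L ('a \<times> 'b))" where
  "upper_triangular_op A C B = CBlinfun (\<lambda>(x, y). (A x + C y, B y))"

lemma upper_triangular_op_apply:
  "cblinfun_apply (upper_triangular_op A C B) (x, y) = (A x + C y, B y)"
proof -
  have "bounded_linear (\<lambda>p. (A (fst p) + C (snd p), B (snd p)))"
    by (intro bounded_linear_Pair bounded_linear_add
        bounded_linear_compose[OF cblinfun_apply_bounded_linear]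
        bounded_linear_fst bounded_linear_snd)
  then have "bounded_clinear (\<lambda>(x, y). (A x + C y, B y))"
    by (auto simp: bounded_clinear_iff case_prod_unfold scaleC_prod_def scaleC_add_right
        cblinfun_apply_scaleC)
  then show ?thesis
    by (simp add: upper_triangular_op_def CBlinfun_inverse)
qed

section \<open>The generalized Kato spectrum\<close>

text \<open>
  In the following definitions \<open>M\<close> is a closed \<open>T\<close>-invariant subspace, and the predicate
  speaks about the restriction of \<open>T\<close> to \<open>M\<close> as an operator on the Banach space \<open>M\<close>; for
  \<open>M = UNIV\<close> it is the property of \<open>T\<close> itself.
\<close>

definition invariant_closed_subspace ::
    "('a::complex_normed_vector \<Rightarrow>\<^sub>C\<^sub>L 'a) \<Rightarrow> 'a set \<Rightarrow> bool" where
  "invariant_closed_subspace T M \<longleftrightarrow>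
     complex_vector.subspace M \<and> closed M \<and> T ` M \<subseteq> M"

definition semi_regular_on :: "('a::complex_normed_vector \<Rightarrow>\<^sub>C\<^sub>L 'a) \<Rightarrow> 'a set \<Rightarrow> bool" where
  "semi_regular_on T M \<longleftrightarrow>
     closedin (top_of_set M) (T ` M) \<and>
     {x \<in> M. T x = 0} \<subseteq> (\<Inter>n. (cblinfun_apply T ^^ n) ` M)"

definition invertible_on :: "('a::complex_normed_vector \<Rightarrow>\<^sub>C\<^sub>L 'a) \<Rightarrow> 'a set \<Rightarrow> bool" where
  "invertible_on T M \<longleftrightarrow>
     bij_betw T M M \<and> (\<exists>K. \<forall>y\<in>M. norm (inv_into M T y) \<le> K * norm y)"

definition spectrum_on :: "('a::complex_normed_vector \<Rightarrow>\<^sub>C\<^sub>L 'a) \<Rightarrow> 'a set \<Rightarrow> complex set" where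
  "spectrum_on T M = {z. \<not> invertible_on (T - z *\<^sub>C id_cblinfun) M}"

text \<open>
  Spectral radius zero. Inclusion instead of equality, because the spectrum is empty on
  the zero space.
\<close>

definition quasinilpotent_on :: "('a::complex_normed_vector \<Rightarrow>\<^sub>C\<^sub>L 'a) \<Rightarrow> 'a set \<Rightarrow> bool" where
  "quasinilpotent_on T N \<longleftrightarrow> spectrum_on T N \<subseteq> {0}"

definition pseudo_fredholm :: "('a::complex_banach \<Rightarrow>\<^sub>C\<^sub>L 'a) \<Rightarrow> bool" where
  "pseudo_fredholm T \<longleftrightarrow>
     (\<exists>M N. invariant_closed_subspace T M \<and> invariant_closed_subspace T N \<and>
        M \<inter> N = {0} \<and> (\<forall>z. \<exists>x\<in>M. \<exists>y\<in>N. z = x + y) \<and>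
        semi_regular_on T M \<and> quasinilpotent_on T N)"

definition gK_spectrum :: "('a::complex_banach \<Rightarrow>\<^sub>C\<^sub>L 'a) \<Rightarrow> complex set" where
  "gK_spectrum T = {z. \<not> pseudo_fredholm (T - z *\<^sub>C id_cblinfun)}"

section \<open>The single-valued extension property\<close>

text \<open>
  Complex differentiability at every point; used for open \<open>U\<close> only, where this is analyticity.
\<close>

definition vector_analytic_on ::
    "(complex \<Rightarrow> 'a::complex_normed_vector) \<Rightarrow> complex set \<Rightarrow> bool" where
  "vector_analytic_on f U \<longleftrightarrow>
     (\<forall>z\<in>U. \<exists>d. (f has_derivative (\<lambda>h. h *\<^sub>C d)) (at z))"

definition SVEP_at :: "('a::complex_banach \<Rightarrow>\<^sub>C\<^sub>L 'a) \<Rightarrow> complex \<Rightarrow> bool" where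
  "SVEP_at T z0 \<longleftrightarrow>
     (\<forall>U f. open U \<and> z0 \<in> U \<and> vector_analytic_on f U \<and>
        (\<forall>z\<in>U. (T - z *\<^sub>C id_cblinfun) (f z) = 0) \<longrightarrow> (\<forall>z\<in>U. f z = 0))"

definition SVEP :: "('a::complex_banach \<Rightarrow>\<^sub>C\<^sub>L 'a) \<Rightarrow> bool" where
  "SVEP T \<longleftrightarrow> (\<forall>z. SVEP_at T z)"

end

theory Submission
  imports Defs
begin

text \<open>
The idea is to replace the generalized Kato spectrum by the set of limit points of the ordinary
spectrum, which is well behaved for triangular matrices.

Suppose that \<open>T\<close> and its adjoint have the single-valued extension property, and that \<open>T - l\<close> is
pseudo-Fredholm with summands \<open>M\<close> and \<open>N\<close>. On \<open>M\<close> the operator \<open>S = T - l\<close> is semi-regular. A nonzero kernel vector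
of \<open>S\<close> on \<open>M\<close> could be continued to a backward orbit with geometrically bounded norms, and a nonzero functional annihilating
the range of \<open>S\<close> on \<open>M\<close> to such an orbit of the adjoint; the power series with these coefficients
would be nonzero analytic solutions of \<open>(T - z) f z = 0\<close>, or of the corresponding equation for the adjoint, near \<open>l\<close>
(\<open>SVEP_eigenvector_chain\<close>). Hence \<open>S\<close> is bijective on \<open>M\<close>
(\<open>semi_regular_SVEP_inj\<close>, \<open>semi_regular_adjoint_SVEP_surj\<close>); the bounds come from the
open mapping theorem and the functionals from the Hahn-Banach theorem. As \<open>S\<close> is quasinilpotent on \<open>N\<close>, all \<open>T - z\<close>
with \<open>z \<noteq> l\<close> close to \<open>l\<close> are bijective, so \<open>l\<close> is not a limit point of the spectrum
(\<open>pseudo_fredholm_imp_not_islimpt\<close>).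

Conversely, if \<open>l\<close> is not a limit point of the spectrum, the Riesz projection, the mean of \<open>z (z - S)^{-1}\<close> over a
small circle, splits the space into a part on which \<open>S\<close> is bijective and a part on which it is
quasinilpotent (\<open>not_islimpt_imp_pseudo_fredholm\<close>). The only analytic fact needed is that
the mean does not depend on the radius; everything else follows from the recursion between the Laurent coefficients of the
resolvent and from their growth on two circles of different radius.

Together, \<open>gK_spectrum_eq_limit_points\<close> describes the generalized Kato spectra of \<open>A\<close>, of \<open>B\<close>, and also of
the matrix, since the matrix and its adjoint inherit the extension property from the diagonal. Finally, the
extension property of \<open>B\<close> makes the spectrum of the matrix equal to the union of the spectra of \<open>A\<close> and
\<open>B\<close> (\<open>spectrum_upper_triangular\<close>), and a limit point of a union of two sets is a limit point of one of them.
\<close>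

section \<open>The open mapping theorem\<close>

lemma suminf_in_closed_subspace:
  fixes f :: "nat \<Rightarrow> 'a::real_normed_vector"
  assumes M: "subspace M" "closed M" and f: "\<And>n. f n \<in> M" and s: "summable f"
  shows "suminf f \<in> M"
proof (rule closed_sequentially[OF M(2)])
  show "\<And>n. (\<Sum>i<n. f i) \<in> M"
    using M(1) f by (intro subspace_sum) auto
  show "(\<lambda>n. \<Sum>i<n. f i) \<longlonglongrightarrow> suminf f"
    using s by (simp add: summable_LIMSEQ)
qed

text \<open>
The image \<open>R\<close> is itself a complete metric space, so by Baire's theorem one of the closures of
the images of the balls of radius \<open>n\<close> has interior points in \<open>R\<close>. Differences of two points
near the centre fill a neighbourhood of the origin up to arbitrarily small errors; homogeneity then
gives an approximate preimage with a relative error of one half.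
\<close>

lemma open_mapping_approx:
  fixes T :: "'a::banach \<Rightarrow> 'b::banach"
  assumes T: "bounded_linear T" and M: "subspace M" and R: "closed (T ` M)"
  obtains K where "K > 0"
    "\<And>y. y \<in> T ` M \<Longrightarrow> \<exists>x\<in>M. norm x \<le> K * norm y \<and> norm (y - T x) \<le> norm y / 2"
proof -
  interpret T: bounded_linear T by (rule T)
  define R where "R = T ` M"
  have subR: "subspace R"
    unfolding R_def using M T.linear_axioms by (rule linear_subspace_image[rotated])
  define D where "D n = R \<inter> closure (T ` (M \<inter> cball 0 (real n)))" for n
  have cm: "completely_metrizable_space (top_of_set R)"
    using R by (intro completely_metrizable_space_closedin completely_metrizable_space_euclidean)
      (simp add: R_def)
  have "R \<subseteq> \<Union>(range D)"
  proof
    fix y assume y: "y \<in> R"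
    then obtain x where x: "x \<in> M" "y = T x" by (auto simp: R_def)
    obtain n where "norm x \<le> real n" using real_arch_simple by blast
    then have "y \<in> D n"
      using x y by (auto simp: D_def intro!: closure_subset[THEN subsetD])
    then show "y \<in> \<Union>(range D)" by blast
  qed
  then have "\<Union>(range D) = R" by (auto simp: D_def)
  then have int: "top_of_set R interior_of \<Union>(range D) = R"
    by (metis interior_of_topspace topspace_euclidean_subtopology)
  have "\<exists>n. top_of_set R interior_of D n \<noteq> {}"
  proof (rule ccontr)
    assume "\<not> ?thesis"
    then have "top_of_set R interior_of \<Union>(range D) = {}"
      by (intro Baire_category_alt) (auto simp: cm D_def closedin_closed_Int)
    with int subspace_0[OF subR] show False by auto
  qed
  then obtain n y0 where y0: "y0 \<in> top_of_set R interior_of D n" by blast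
  then obtain U where U: "openin (top_of_set R) U" "y0 \<in> U" "U \<subseteq> D n"
    by (auto simp: interior_of_def)
  then obtain e where e: "e > 0" "ball y0 e \<inter> R \<subseteq> U"
    by (meson openin_contains_ball)
  have y0R: "y0 \<in> R" using U openin_subset by fastforce
  have near: "\<exists>x\<in>M. norm x \<le> 2 * real n \<and> norm (y - T x) < d"
    if y: "y \<in> R" "norm y < e" and d: "d > 0" for y d
  proof -
    have "y0 + y \<in> D n" "y0 \<in> D n"
      using e U y y0R subspace_add[OF subR] by (auto simp: dist_norm subset_iff)
    then have cl: "y0 + y \<in> closure (T ` (M \<inter> cball 0 (real n)))"
        "y0 \<in> closure (T ` (M \<inter> cball 0 (real n)))"
      by (auto simp: D_def)
    have "d/2 > 0" using d by simp
    then obtain u' v' where u': "u' \<in> T ` (M \<inter> cball 0 (real n))" "dist u' (y0 + y) < d/2"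
      and v': "v' \<in> T ` (M \<inter> cball 0 (real n))" "dist v' y0 < d/2"
      using cl unfolding closure_approachable by meson
    from u' obtain u where u: "u \<in> M" "norm u \<le> n" "dist (T u) (y0 + y) < d/2" by auto
    from v' obtain v where v: "v \<in> M" "norm v \<le> n" "dist (T v) y0 < d/2" by auto
    show ?thesis
    proof (intro bexI conjI)
      show "u - v \<in> M" using u v M subspace_diff by blast
      show "norm (u - v) \<le> 2 * real n" using u v norm_triangle_ineq4[of u v] by linarith
      have "norm (y - T (u - v)) = norm ((T v - y0) - (T u - (y0 + y)))"
        by (simp add: T.diff algebra_simps)
      also have "\<dots> < d" using u v norm_triangle_ineq4[of "T v - y0" "T u - (y0 + y)"]
        by (simp add: dist_norm)
      finally show "norm (y - T (u - v)) < d" .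
    qed
  qed
  define K where "K = 4 * real n / e + 1"
  show thesis
  proof (rule that[of K])
    show "K > 0" using e(1) by (simp add: K_def add_nonneg_pos)
    fix y assume "y \<in> T ` M"
    then have y: "y \<in> R" by (simp add: R_def)
    show "\<exists>x\<in>M. norm x \<le> K * norm y \<and> norm (y - T x) \<le> norm y / 2"
    proof (cases "y = 0")
      case True
      then show ?thesis using subspace_0[OF M] by (intro bexI[of _ 0]) (auto simp: T.zero)
    next
      case False
      define s where "s = e / (2 * norm y)"
      have s: "s > 0" using e False by (simp add: s_def)
      have sy: "norm (s *\<^sub>R y) = e / 2" using e False by (simp add: s_def)
      obtain x where x: "x \<in> M" "norm x \<le> 2 * n" "norm (s *\<^sub>R y - T x) < e / 4"
        using near[of "s *\<^sub>R y" "e/4"] y e sy subspace_scale[OF subR] by auto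
      show ?thesis
      proof (intro bexI conjI)
        show "(1/s) *\<^sub>R x \<in> M" using x M subspace_scale by blast
        have "norm ((1/s) *\<^sub>R x) \<le> (1/s) * (2 * n)" using s x by (simp add: divide_simps)
        also have "\<dots> = (4 * real n / e) * norm y" using e False by (simp add: s_def field_simps)
        also have "\<dots> \<le> K * norm y" by (intro mult_right_mono) (auto simp: K_def)
        finally show "norm ((1/s) *\<^sub>R x) \<le> K * norm y" .
        have "y - T ((1/s) *\<^sub>R x) = (1/s) *\<^sub>R (s *\<^sub>R y - T x)"
          using s by (simp add: T.scaleR algebra_simps)
        then have "norm (y - T ((1/s) *\<^sub>R x)) = (1/s) * norm (s *\<^sub>R y - T x)"
          using s by simp
        also have "\<dots> \<le> (1/s) * (e/4)" using x s by (intro mult_left_mono) auto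
        also have "\<dots> = norm y / 2" using e False by (simp add: s_def field_simps)
        finally show "norm (y - T ((1/s) *\<^sub>R x)) \<le> norm y / 2" .
      qed
    qed
  qed
qed

text \<open>
Iterating the approximate solution on the remaining error halves the error in every step, and
the corrections form a geometrically convergent series. Everything is phrased on a closed subspace
\<open>M\<close>, because it will be applied to restrictions of an operator to a summand.
\<close>

lemma open_mapping_bound:
  fixes T :: "'a::banach \<Rightarrow> 'b::banach"
  assumes T: "bounded_linear T" and M: "subspace M" "closed M" and R: "closed (T ` M)"
  obtains K where "K > 0" "\<And>y. y \<in> T ` M \<Longrightarrow> \<exists>x\<in>M. T x = y \<and> norm x \<le> K * norm y"
proof -
  interpret T: bounded_linear T by (rule T)
  have subR: "subspace (T ` M)"
    using M T.linear_axioms by (intro linear_subspace_image)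
  obtain K where K: "K > 0"
    "\<And>y. y \<in> T ` M \<Longrightarrow> \<exists>x\<in>M. norm x \<le> K * norm y \<and> norm (y - T x) \<le> norm y / 2"
    using open_mapping_approx[OF T M(1) R] by blast
  then obtain g where g: "\<And>y. y \<in> T ` M \<Longrightarrow> g y \<in> M \<and> norm (g y) \<le> K * norm y \<and>
      norm (y - T (g y)) \<le> norm y / 2" by metis
  show thesis
  proof (rule that[of "2 * K"])
    show "2 * K > 0" using K by simp
    fix y assume y: "y \<in> T ` M"
    define r where "r k = ((\<lambda>y. y - T (g y)) ^^ k) y" for k
    have r0: "r 0 = y" and rS: "r (Suc k) = r k - T (g (r k))" for k by (simp_all add: r_def)
    have rR: "r k \<in> T ` M" for k
    proof (induction k)
      case (Suc k)
      then show ?case using g[OF Suc] subspace_diff[OF subR] by (simp add: rS)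
    qed (simp add: r0 y)
    have rb: "norm (r k) \<le> norm y * (1/2)^k" for k
    proof (induction k)
      case (Suc k)
      then show ?case using g[OF rR, of k] by (simp add: rS)
    qed (simp add: r0)
    have gb: "norm (g (r k)) \<le> (K * norm y) * (1/2)^k" for k
    proof -
      have "norm (g (r k)) \<le> K * norm (r k)" using g[OF rR] by blast
      also have "\<dots> \<le> K * (norm y * (1/2)^k)" using rb K(1) by (intro mult_left_mono) auto
      finally show ?thesis by (simp add: mult.assoc)
    qed
    have sumb: "summable (\<lambda>k. (K * norm y) * (1/2::real)^k)"
      by (intro summable_mult summable_geometric) simp
    have sg: "summable (\<lambda>k. g (r k))"
      by (rule summable_comparison_test'[OF sumb]) (rule gb)
    define x where "x = (\<Sum>k. g (r k))"
    show "\<exists>x\<in>M. T x = y \<and> norm x \<le> 2 * K * norm y"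
    proof (intro bexI conjI)
      show "x \<in> M" unfolding x_def
        by (rule suminf_in_closed_subspace[OF M _ sg]) (use g rR in auto)
      have "r \<longlonglongrightarrow> 0"
      proof (rule Lim_null_comparison)
        show "\<forall>\<^sub>F k in sequentially. norm (r k) \<le> norm y * (1/2)^k" using rb by simp
        show "(\<lambda>k. norm y * (1/2)^k) \<longlonglongrightarrow> 0"
          by (intro tendsto_mult_right_zero LIMSEQ_realpow_zero) auto
      qed
      then have "(\<lambda>k. r k - r (Suc k)) sums (r 0 - 0)" by (rule telescope_sums')
      then have "(\<lambda>k. T (g (r k))) sums y" by (simp add: rS r0)
      moreover have "(\<lambda>k. T (g (r k))) sums T x"
        unfolding x_def by (rule T.sums[OF summable_sums[OF sg]])
      ultimately show "T x = y" using sums_unique2 by blast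
      have "norm x \<le> (\<Sum>k. (K * norm y) * (1/2::real)^k)"
        unfolding x_def by (rule norm_suminf_le[OF gb sumb])
      also have "\<dots> = 2 * K * norm y" by (subst suminf_mult) (auto simp: suminf_geometric)
      finally show "norm x \<le> 2 * K * norm y" .
    qed
  qed
qed

section \<open>The Hahn-Banach theorem\<close>

text \<open>
Partial functionals are represented by their graphs. The value \<open>c\<close> at the new vector \<open>x0\<close>
has to lie above all numbers \<open>b - p (y - x0)\<close> and below all numbers \<open>p (x + x0) - a\<close>, and
subadditivity of \<open>p\<close> says exactly that no number of the first kind exceeds one of the second.
\<close>

lemma Hahn_Banach_graph_extend:
  fixes G :: "('a::real_vector \<times> real) set" and p :: "'a \<Rightarrow> real"
  assumes G: "subspace G" and le: "\<And>x a. (x, a) \<in> G \<Longrightarrow> a \<le> p x"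
    and add: "\<And>x y. p (x + y) \<le> p x + p y" and scale: "\<And>t x. t \<ge> 0 \<Longrightarrow> p (t *\<^sub>R x) = t * p x"
  obtains c where "\<And>x a t. (x, a) \<in> G \<Longrightarrow> a + t * c \<le> p (x + t *\<^sub>R x0)"
proof -
  define L where "L = (\<lambda>(y, b). b - p (y - x0)) ` G"
  have cross: "b - p (y - x0) \<le> p (x + x0) - a" if "(y, b) \<in> G" "(x, a) \<in> G" for x y a b
  proof -
    have "(y + x, b + a) \<in> G" using subspace_add[OF G that] by simp
    from le[OF this] add[of "y - x0" "x + x0"] show ?thesis by (simp add: algebra_simps)
  qed
  have 0: "(0, 0) \<in> G" using subspace_0[OF G] by (simp add: zero_prod_def)
  define c where "c = Sup L"
  have c1: "b - p (y - x0) \<le> c" if "(y, b) \<in> G" for y b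
    unfolding c_def
  proof (rule cSup_upper)
    show "bdd_above L" using cross[OF _ 0] by (force simp: L_def intro!: bdd_aboveI[of _ "p (0 + x0) - 0"])
  qed (use that in \<open>force simp: L_def\<close>)
  have c2: "c \<le> p (x + x0) - a" if "(x, a) \<in> G" for x a
    unfolding c_def
  proof (rule cSup_least)
    show "L \<noteq> {}" using 0 by (auto simp: L_def)
  qed (use cross[OF _ that] in \<open>force simp: L_def\<close>)
  have "a + t * c \<le> p (x + t *\<^sub>R x0)" if xa: "(x, a) \<in> G" for x a t
  proof (cases t "0::real" rule: linorder_cases)
    case equal
    then show ?thesis using le[OF xa] by simp
  next
    case greater
    have "((1/t) *\<^sub>R x, a / t) \<in> G" using subspace_scale[OF G xa, of "1/t"] by simp
    from c2[OF this] have "t * c \<le> t * (p ((1/t) *\<^sub>R x + x0) - a / t)"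
      using greater by (intro mult_left_mono) auto
    also have "\<dots> = p (x + t *\<^sub>R x0) - a"
      using greater scale[of t "(1/t) *\<^sub>R x + x0"] by (simp add: algebra_simps)
    finally show ?thesis by simp
  next
    case less
    have "((-1/t) *\<^sub>R x, - a / t) \<in> G" using subspace_scale[OF G xa, of "-1/t"] by simp
    from c1[OF this] have "(-t) * (- a / t - p ((-1/t) *\<^sub>R x - x0)) \<le> (-t) * c"
      using less by (intro mult_left_mono) auto
    also have "(-t) * (- a / t - p ((-1/t) *\<^sub>R x - x0)) = a - p (x + t *\<^sub>R x0)"
      using less scale[of "-t" "(-1/t) *\<^sub>R x - x0"] by (simp add: algebra_simps)
    finally show ?thesis by simp
  qed
  then show thesis by (rule that)
qed

text \<open>
A linear relation below the graph of \<open>p\<close> is automatically single-valued, since it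
contains \<open>(0, t)\<close> only if both \<open>t\<close> and \<open>- t\<close> are at most \<open>p 0 = 0\<close>. So Zorn's lemma can be
applied to plain subspaces of the product, ordered by inclusion, and a maximal one is the graph of
a total function.
\<close>

lemma Hahn_Banach_real:
  fixes G0 :: "('a::real_vector \<times> real) set" and p :: "'a \<Rightarrow> real"
  assumes G0: "subspace G0" and le: "\<And>x a. (x, a) \<in> G0 \<Longrightarrow> a \<le> p x"
    and add: "\<And>x y. p (x + y) \<le> p x + p y" and scale: "\<And>t x. t \<ge> 0 \<Longrightarrow> p (t *\<^sub>R x) = t * p x"
  obtains f where "linear f" "\<And>x. f x \<le> p x" "\<And>x a. (x, a) \<in> G0 \<Longrightarrow> f x = a"
proof -
  define \<A> where "\<A> = {G. subspace G \<and> G0 \<subseteq> G \<and> (\<forall>x a. (x, a) \<in> G \<longrightarrow> a \<le> p x)}"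
  have "\<exists>G\<in>\<A>. \<forall>X\<in>\<A>. G \<subseteq> X \<longrightarrow> X = G"
  proof (rule subset_Zorn_nonempty)
    show "\<A> \<noteq> {}" using G0 le by (auto simp: \<A>_def)
    fix \<C> assume ne: "\<C> \<noteq> {}" and ch: "subset.chain \<A> \<C>"
    then have C: "\<And>G. G \<in> \<C> \<Longrightarrow> G \<in> \<A>" and tot: "\<And>G H. G \<in> \<C> \<Longrightarrow> H \<in> \<C> \<Longrightarrow> G \<subseteq> H \<or> H \<subseteq> G"
      by (auto simp: subset.chain_def)
    have sub: "subspace H" if "H \<in> \<C>" for H
      using C[OF that] by (simp add: \<A>_def)
    have "subspace (\<Union>\<C>)"
    proof (rule subspaceI)
      obtain H where "H \<in> \<C>" using ne by blast
      then show "0 \<in> \<Union>\<C>" using subspace_0[OF sub] by blast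
      show "c *\<^sub>R x \<in> \<Union>\<C>" if "x \<in> \<Union>\<C>" for c x
        using that subspace_scale[OF sub] by blast
      show "x + y \<in> \<Union>\<C>" if xy: "x \<in> \<Union>\<C>" "y \<in> \<Union>\<C>" for x y
      proof -
        obtain G H where GH: "G \<in> \<C>" "H \<in> \<C>" "x \<in> G" "y \<in> H" using xy by blast
        then obtain W where "W \<in> \<C>" "x \<in> W" "y \<in> W" using tot[of G H] by blast
        then show ?thesis using subspace_add[OF sub] by blast
      qed
    qed
    then show "\<Union>\<C> \<in> \<A>" using ne C by (auto simp: \<A>_def)
  qed
  then obtain G where "G \<in> \<A>" and max: "\<And>X. X \<in> \<A> \<Longrightarrow> G \<subseteq> X \<Longrightarrow> X = G" by blast
  then have G: "subspace G" "G0 \<subseteq> G" and Gle: "\<And>x a. (x, a) \<in> G \<Longrightarrow> a \<le> p x"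
    by (auto simp: \<A>_def)
  have p0: "p 0 = 0" using scale[of 0 0] by simp
  have single: "a = b" if "(x, a) \<in> G" "(x, b) \<in> G" for x a b
  proof -
    have "(0, a - b) \<in> G" "(0, b - a) \<in> G"
      using subspace_diff[OF G(1) that] subspace_diff[OF G(1) that(2,1)] by simp_all
    from Gle[OF this(1)] Gle[OF this(2)] show ?thesis by (simp add: p0)
  qed
  have total: "\<exists>a. (x0, a) \<in> G" for x0
  proof -
    obtain c where c: "\<And>x a t. (x, a) \<in> G \<Longrightarrow> a + t * c \<le> p (x + t *\<^sub>R x0)"
      using Hahn_Banach_graph_extend[OF G(1) Gle add scale] by blast
    define X where "X = {u + v |u v. u \<in> G \<and> v \<in> range (\<lambda>t. t *\<^sub>R (x0, c))}"
    have "subspace (range (\<lambda>t. t *\<^sub>R (x0, c)))"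
      using subspace_span[of "{(x0, c)}"] by (simp add: span_singleton)
    then have sX: "subspace X" unfolding X_def using G(1) by (intro subspace_sums)
    have GX: "G \<subseteq> X"
    proof
      fix w assume "w \<in> G"
      moreover have "0 \<in> range (\<lambda>t. t *\<^sub>R (x0, c))" by (rule image_eqI[of _ _ 0]) (auto simp: zero_prod_def)
      moreover have "w = w + 0" by simp
      ultimately show "w \<in> X" unfolding X_def by blast
    qed
    have "X \<in> \<A>" unfolding \<A>_def mem_Collect_eq
    proof (intro conjI allI impI)
      fix x a assume "(x, a) \<in> X"
      then obtain y b t where "(y, b) \<in> G" "x = y + t *\<^sub>R x0" "a = b + t * c"
        by (auto simp: X_def)
      then show "a \<le> p x" using c by simp
    qed (use sX G GX in auto)
    then have "X = G" using max GX by blast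
    moreover have "(x0, c) \<in> X"
    proof -
      have "(x0, c) = 0 + 1 *\<^sub>R (x0, c)" by (simp add: zero_prod_def)
      then show ?thesis unfolding X_def using subspace_0[OF G(1)] by blast
    qed
    ultimately show ?thesis by blast
  qed
  define f where "f x = (THE a. (x, a) \<in> G)" for x
  have fG: "(x, f x) \<in> G" for x
    unfolding f_def using total[of x] single by (metis theI)
  have feq: "(x, a) \<in> G \<Longrightarrow> f x = a" for x a using single fG by blast
  show thesis
  proof (rule that)
    show "linear f"
    proof (rule linearI)
      show "f (x + y) = f x + f y" for x y using subspace_add[OF G(1) fG[of x] fG[of y]] by (intro feq) simp
      show "f (t *\<^sub>R x) = t *\<^sub>R f x" for t x using subspace_scale[OF G(1) fG[of x], of t] by (intro feq) simp
    qed
    show "f x \<le> p x" for x using Gle fG by blast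
    show "f x = a" if "(x, a) \<in> G0" for x a using that G feq by blast
  qed
qed

text \<open>
The graph form of the hypothesis spares a separate well-definedness argument in applications, where
functionals are prescribed on the range of an operator. The complex functional is recovered from
its real part \<open>u\<close> as \<open>u x - \<i> u (\<i> x)\<close>, and rotating \<open>x\<close> so that the value becomes real and nonnegative
transfers the bound from \<open>u\<close>.
\<close>

lemma Hahn_Banach_complex:
  fixes G :: "('a::complex_normed_vector \<times> complex) set"
  assumes G: "complex_vector.subspace G" and le: "\<And>x a. (x, a) \<in> G \<Longrightarrow> cmod a \<le> K * norm x"
    and K: "K \<ge> 0"
  obtains \<phi> :: "'a cdual" where "\<And>x a. (x, a) \<in> G \<Longrightarrow> \<phi> x = a" "\<And>x. cmod (\<phi> x) \<le> K * norm x"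
proof -
  define G0 where "G0 = (\<lambda>(x, a). (x, Re a)) ` G"
  have Gs: "(c *\<^sub>C x, c * a) \<in> G" if "(x, a) \<in> G" for c x a
    using complex_vector.subspace_scale[OF G that, of c]
    by (simp add: scaleC_prod_def scaleC_complex_def)
  have "subspace G0"
  proof (rule subspaceI)
    show "0 \<in> G0" using complex_vector.subspace_0[OF G]
      by (force simp: G0_def zero_prod_def)
    show "x + y \<in> G0" if "x \<in> G0" "y \<in> G0" for x y
    proof -
      from that obtain x1 a1 x2 a2 where *: "(x1, a1) \<in> G" "x = (x1, Re a1)" "(x2, a2) \<in> G" "y = (x2, Re a2)"
        by (auto simp: G0_def)
      then have "(x1 + x2, a1 + a2) \<in> G" using complex_vector.subspace_add[OF G *(1,3)] by simp
      then show ?thesis using * by (force simp: G0_def)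
    qed
    show "t *\<^sub>R x \<in> G0" if "x \<in> G0" for t x
    proof -
      from that obtain x1 a1 where *: "(x1, a1) \<in> G" "x = (x1, Re a1)" by (auto simp: G0_def)
      from Gs[OF *(1), of "of_real t"] show ?thesis using *
        by (force simp: G0_def scaleC_of_real)
    qed
  qed
  then obtain u where u: "linear u" "\<And>x. u x \<le> K * norm x" "\<And>x a. (x, a) \<in> G0 \<Longrightarrow> u x = a"
  proof (rule Hahn_Banach_real[where p = "\<lambda>x. K * norm x"])
    fix x y :: 'a
    show "K * norm (x + y) \<le> K * norm x + K * norm y"
      using mult_left_mono[OF norm_triangle_ineq K] by (simp add: distrib_left)
  next
    fix x a assume "(x, a) \<in> G0"
    then show "a \<le> K * norm x" using le complex_Re_le_cmod order_trans by (fastforce simp: G0_def)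
  qed auto
  interpret u: linear u by (rule u)
  have uG: "u x = Re a" if "(x, a) \<in> G" for x a using that by (intro u(3)) (force simp: G0_def)
  define f where "f x = Complex (u x) (- u (\<i> *\<^sub>C x))" for x
  have fadd: "f (x + y) = f x + f y" for x y
    by (simp add: f_def complex_eq_iff scaleC_add_right u.add)
  have comm: "\<i> *\<^sub>C (t *\<^sub>R x) = t *\<^sub>R (\<i> *\<^sub>C x)" for t and x :: 'a
    unfolding scaleC_of_real[symmetric] scaleC_scaleC by (simp only: mult.commute)
  have freal: "f (t *\<^sub>R x) = of_real t * f x" for t x
    by (simp add: f_def complex_eq_iff u.scale comm)
  have fi: "f (\<i> *\<^sub>C x) = \<i> * f x" for x
    using u.neg[of x] scaleC_of_real[of "-1" x] by (simp add: f_def complex_eq_iff scaleC_scaleC)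
  have fC: "f (c *\<^sub>C x) = c * f x" for c x
  proof -
    have "c *\<^sub>C x = (of_real (Re c) + \<i> * of_real (Im c)) *\<^sub>C x"
      by (simp only: complex_eq[symmetric])
    also have "\<dots> = Re c *\<^sub>R x + \<i> *\<^sub>C (Im c *\<^sub>R x)"
      by (simp only: scaleC_of_real[symmetric] scaleC_add_left scaleC_scaleC)
    finally have "f (c *\<^sub>C x) = (of_real (Re c) + \<i> * of_real (Im c)) * f x"
      by (simp only: fadd freal fi distrib_right mult.assoc)
    then show ?thesis by (simp only: complex_eq[symmetric])
  qed
  have fb: "cmod (f x) \<le> K * norm x" for x
  proof (cases "f x = 0")
    case False
    define c where "c = cnj (sgn (f x))"
    have c: "cmod c = 1" using False by (simp add: c_def norm_sgn)
    have "c * f x = of_real (cmod (f x))"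
      using False by (simp add: c_def sgn_div_norm scaleR_conv_of_real complex_norm_square[symmetric]
          mult.commute divide_simps power2_eq_square)
    then have "cmod (f x) = Re (f (c *\<^sub>C x))" by (simp add: fC)
    also have "\<dots> \<le> K * norm (c *\<^sub>C x)" using u(2)[of "c *\<^sub>C x"] by (simp add: f_def)
    also have "\<dots> = K * norm x" by (simp add: norm_scaleC c)
    finally show ?thesis .
  qed (simp add: K)
  have "bounded_clinear f"
  proof (rule bounded_clinearI)
    show "bounded_linear f"
      by (rule bounded_linear_intro[where K = K])
        (use fadd freal fb in \<open>auto simp: mult.commute scaleR_conv_of_real\<close>)
  qed (simp add: fC scaleC_complex_def)
  then have app: "cblinfun_apply (CBlinfun f) = f" by (simp add: CBlinfun_inverse)
  show thesis
  proof (rule that[of "CBlinfun f"])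
    fix x a assume xa: "(x, a) \<in> G"
    have "u (\<i> *\<^sub>C x) = - Im a" using uG[OF Gs[OF xa, of \<i>]] by simp
    then show "CBlinfun f x = a" unfolding app using uG[OF xa] by (simp add: f_def complex_eq_iff)
  qed (simp add: app fb)
qed

section \<open>Complex scaling, shifts, and eigenvector chains\<close>

lemma bounded_bilinear_scaleC:
  "bounded_bilinear (scaleC :: complex \<Rightarrow> 'a::complex_normed_vector \<Rightarrow> 'a)"
proof
  fix r :: real and c :: complex and x :: 'a
  show "(r *\<^sub>R c) *\<^sub>C x = r *\<^sub>R (c *\<^sub>C x)"
    by (simp add: scaleC_scaleC scaleR_conv_of_real flip: scaleC_of_real)
  show "c *\<^sub>C (r *\<^sub>R x) = r *\<^sub>R (c *\<^sub>C x)"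
    by (simp add: scaleC_scaleC mult.commute flip: scaleC_of_real)
  show "\<exists>K. \<forall>c (x :: 'a). norm (c *\<^sub>C x) \<le> norm c * norm x * K"
    by (rule exI[of _ 1]) (simp add: norm_scaleC)
qed (simp_all add: scaleC_add_left scaleC_add_right)

interpretation scaleC: bounded_bilinear "scaleC :: complex \<Rightarrow> 'a::complex_normed_vector \<Rightarrow> 'a"
  by (rule bounded_bilinear_scaleC)

lemmas cblinfun_sums = bounded_linear.sums[OF cblinfun_apply_bounded_linear]
  and cblinfun_add = linear_add[OF bounded_linear.linear[OF cblinfun_apply_bounded_linear]]
  and cblinfun_diff = linear_diff[OF bounded_linear.linear[OF cblinfun_apply_bounded_linear]]
  and cblinfun_minus = linear_neg[OF bounded_linear.linear[OF cblinfun_apply_bounded_linear]]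
  and cblinfun_zero = linear_0[OF bounded_linear.linear[OF cblinfun_apply_bounded_linear]]

lemma csubspace_imp_subspace:
  assumes "complex_vector.subspace M"
  shows "subspace M"
  using assms unfolding subspace_def complex_vector.subspace_def
  by (auto simp flip: scaleC_of_real)

lemma norm_cblinfun_bound:
  fixes T :: "'a::complex_normed_vector \<Rightarrow>\<^sub>C\<^sub>L 'b::complex_normed_vector"
  assumes "K \<ge> 0" "\<And>x. norm (T x) \<le> K * norm x"
  shows "norm T \<le> K"
  using assms by (simp add: norm_cblinfun.rep_eq onorm_bound)

lemma shift_op_apply:
  fixes T :: "'a::complex_normed_vector \<Rightarrow>\<^sub>C\<^sub>L 'a"
  shows "cblinfun_apply (T - z *\<^sub>C id_cblinfun) x = T x - z *\<^sub>C x"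
  by (simp add: minus_cblinfun.rep_eq scaleC_cblinfun.rep_eq id_cblinfun.rep_eq)

text \<open>
This is how the single-valued extension property is exploited: the power series
\<open>\<Sum>n. (z - l)^n x n\<close> is analytic near \<open>l\<close> because the chain grows at most geometrically, and
the chain relations telescope to make it a solution of \<open>(T - z) f z = 0\<close>. Its value at \<open>l\<close> is \<open>x 0\<close>.
\<close>

lemma SVEP_eigenvector_chain:
  fixes T :: "'a::complex_banach \<Rightarrow>\<^sub>C\<^sub>L 'a"
  assumes svep: "SVEP T"
    and x0: "T (x 0) = l *\<^sub>C x 0" and xS: "\<And>n. T (x (Suc n)) - l *\<^sub>C x (Suc n) = x n"
    and bound: "\<And>n. norm (x n) \<le> K * L ^ n"
  shows "x 0 = 0"
proof -
  define J where "J = \<bar>L\<bar> + 1"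
  define H where "H = \<bar>K\<bar>"
  have J: "J > 0" by (simp add: J_def)
  have H: "H \<ge> 0" by (simp add: H_def)
  have b: "norm (x n) \<le> H * J ^ n" for n
  proof -
    have "K * L ^ n \<le> \<bar>K * L ^ n\<bar>" by simp
    also have "\<dots> = H * \<bar>L\<bar> ^ n" by (simp add: abs_mult power_abs H_def)
    also have "\<dots> \<le> H * J ^ n" using H by (intro mult_left_mono power_mono) (auto simp: J_def)
    finally show ?thesis using bound order_trans by blast
  qed
  \<comment> \<open>The factor 4 leaves room to absorb the factor \<open>n\<close> of the differentiated series, as \<open>n \<le> 2^n\<close>.\<close>
  define r where "r = 1 / (4 * J)"
  have r: "r > 0" using J by (simp add: r_def)
  define f where "f n z = (z - l) ^ n *\<^sub>C x n" for n z
  define D where "D n z = (of_nat n * (z - l) ^ (n - 1)) *\<^sub>C x n" for n z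
  have Dbound: "norm (D n z) \<le> 4 * J * H * (1/2) ^ n" if z: "z \<in> ball l r" for n z
  proof (cases n)
    case 0
    then show ?thesis using J H by (simp add: D_def)
  next
    case (Suc m)
    have zr: "cmod (z - l) \<le> r" using z by (simp add: dist_norm norm_minus_commute)
    have "norm (D n z) \<le> real n * r ^ m * (H * J ^ n)"
      unfolding D_def Suc norm_scaleC
      using r H J b[of "Suc m"] zr
      by (intro mult_mono) (auto simp: norm_mult norm_power simp del: of_nat_Suc power_Suc intro!: mult_left_mono power_mono)
    also have "r ^ m * J ^ n = J * (1/4) ^ m"
      using J by (simp add: r_def Suc power_divide power_mult_distrib)
    then have "real n * r ^ m * (H * J ^ n) = 4 * J * H * (real n * (1/4) ^ n)"
      by (simp add: Suc mult_ac)
    also have "\<dots> \<le> 4 * J * H * ((1/2) ^ n)"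
    proof (rule mult_left_mono)
      have "real n \<le> 2 ^ n" using of_nat_less_two_power[of n, where 'a = real] by linarith
      then have "real n * (1/4) ^ n \<le> 2 ^ n * (1/4) ^ n" by (intro mult_right_mono) auto
      also have "\<dots> = (1/2::real) ^ n" by (simp flip: power_mult_distrib)
      finally show "real n * (1/4) ^ n \<le> (1/2::real) ^ n" .
    qed (use J H in auto)
    finally show ?thesis .
  qed
  have unif: "uniform_limit (ball l r) (\<lambda>n z. \<Sum>i<n. D i z) (\<lambda>z. \<Sum>i. D i z) sequentially"
    by (rule Weierstrass_m_test[OF Dbound]) (auto intro!: summable_mult summable_geometric)
  have at_l: "(\<lambda>n. f n l) sums x 0"
    using sums_finite[of "{0}" "\<lambda>n. f n l"] by (auto simp: f_def power_0_left)
  have "\<exists>g. \<forall>z\<in>ball l r. (\<lambda>n. f n z) sums g z \<and>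
      (g has_derivative (\<lambda>h. h *\<^sub>C (\<Sum>i. D i z))) (at z within ball l r)"
  proof (rule has_derivative_series[where f' = "\<lambda>n z h. h *\<^sub>C D n z" and x = l and l = "x 0"])
    show "(f n has_derivative (\<lambda>h. h *\<^sub>C D n z)) (at z within ball l r)" for n z
    proof -
      have "((\<lambda>z. (z - l) ^ n) has_derivative (\<lambda>h. h * (of_nat n * (z - l) ^ (n - 1))))
          (at z within ball l r)"
        by (auto intro!: derivative_eq_intros simp: mult_ac)
      from bounded_linear.has_derivative[OF scaleC.bounded_linear_left this] show ?thesis
        by (simp add: f_def[abs_def] D_def scaleC_scaleC)
    qed
    fix e :: real assume "e > 0"
    from uniform_limitD[OF unif this]
    show "\<forall>\<^sub>F n in sequentially. \<forall>z\<in>ball l r. \<forall>h. norm ((\<Sum>i<n. h *\<^sub>C D i z) - h *\<^sub>C (\<Sum>i. D i z)) \<le> e * norm h"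
    proof (rule eventually_mono, intro ballI allI)
      fix n z and h :: complex assume "\<forall>z\<in>ball l r. dist (\<Sum>i<n. D i z) (\<Sum>i. D i z) < e" "z \<in> ball l r"
      then have "norm ((\<Sum>i<n. D i z) - (\<Sum>i. D i z)) \<le> e" unfolding dist_norm using less_imp_le by blast
      then have "norm h * norm ((\<Sum>i<n. D i z) - (\<Sum>i. D i z)) \<le> norm h * e"
        by (intro mult_left_mono) auto
      then show "norm ((\<Sum>i<n. h *\<^sub>C D i z) - h *\<^sub>C (\<Sum>i. D i z)) \<le> e * norm h"
        by (simp add: mult.commute norm_scaleC flip: scaleC.sum_right scaleC.diff_right)
    qed
  next
    show "(\<lambda>n. f n l) sums x 0"
      by (rule at_l)
  qed (use r in auto)
  then obtain g where g: "\<And>z. z \<in> ball l r \<Longrightarrow> (\<lambda>n. f n z) sums g z"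
    "\<And>z. z \<in> ball l r \<Longrightarrow> (g has_derivative (\<lambda>h. h *\<^sub>C (\<Sum>i. D i z))) (at z within ball l r)"
    by blast
  have "vector_analytic_on g (ball l r)"
    unfolding vector_analytic_on_def
    using g(2) at_within_open[OF _ open_ball] by metis
  moreover have "(T - z *\<^sub>C id_cblinfun) (g z) = 0" if z: "z \<in> ball l r" for z
  proof -
    have "(\<lambda>n. T (f (Suc n) z) - l *\<^sub>C f (Suc n) z) sums ((z - l) *\<^sub>C g z)"
    proof -
      have "T (f (Suc n) z) - l *\<^sub>C f (Suc n) z = (z - l) *\<^sub>C f n z" for n
      proof -
        have "T (f (Suc n) z) - l *\<^sub>C f (Suc n) z = (z - l) ^ Suc n *\<^sub>C (T (x (Suc n)) - l *\<^sub>C x (Suc n))"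
          by (simp only: f_def cblinfun_apply_scaleC scaleC.diff_right scaleC_scaleC mult.commute)
        then show ?thesis by (simp add: xS f_def scaleC_scaleC)
      qed
      then show ?thesis using bounded_linear.sums[OF scaleC.bounded_linear_right g(1)[OF z]] by simp
    qed
    then have "(\<lambda>n. T (f n z) - l *\<^sub>C f n z) sums ((z - l) *\<^sub>C g z + (T (f 0 z) - l *\<^sub>C f 0 z))"
      by (subst (asm) sums_Suc_iff) simp
    moreover have "T (f 0 z) - l *\<^sub>C f 0 z = 0" by (simp add: f_def x0)
    moreover have "(\<lambda>n. T (f n z) - l *\<^sub>C f n z) sums (T (g z) - l *\<^sub>C g z)"
      by (intro sums_diff cblinfun_sums bounded_linear.sums[OF scaleC.bounded_linear_right] g(1) z)
    ultimately have "(z - l) *\<^sub>C g z = T (g z) - l *\<^sub>C g z" using sums_unique2 by fastforce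
    then show ?thesis by (simp add: shift_op_apply scaleC.diff_left)
  qed
  ultimately have "\<forall>z\<in>ball l r. g z = 0"
    using svep r unfolding SVEP_def SVEP_at_def by (metis centre_in_ball open_ball)
  moreover have "g l = x 0"
    using sums_unique2[OF g(1) at_l] r by simp
  ultimately show ?thesis using r by auto
qed

section \<open>Semi-regular summands under the single-valued extension property\<close>

lemma open_mapping_cblinfun:
  fixes S :: "'a::complex_banach \<Rightarrow>\<^sub>C\<^sub>L 'b::complex_banach"
  assumes "complex_vector.subspace M" "closed M" "closed (S ` M)"
  obtains K where "K > 0" "\<And>x. x \<in> M \<Longrightarrow> \<exists>u\<in>M. S u = S x \<and> norm u \<le> K * norm (S x)"
  using open_mapping_bound[OF cblinfun_apply_bounded_linear csubspace_imp_subspace] assms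
  by (metis imageI)

lemma closed_image_of_semi_regular:
  assumes "invariant_closed_subspace S M" "semi_regular_on S M"
  shows "closed (S ` M)"
  using assms closedin_closed_trans unfolding invariant_closed_subspace_def semi_regular_on_def by blast

lemma subspace_funpow_image:
  fixes S :: "'a::complex_normed_vector \<Rightarrow>\<^sub>C\<^sub>L 'a"
  assumes "complex_vector.subspace M"
  shows "subspace ((cblinfun_apply S ^^ n) ` M)"
proof (induction n)
  case (Suc n)
  have "(cblinfun_apply S ^^ Suc n) ` M = S ` (cblinfun_apply S ^^ n) ` M" by (simp add: image_comp)
  then show ?case
    using Suc linear_subspace_image[OF bounded_linear.linear[OF cblinfun_apply_bounded_linear]] by metis
qed (simp add: csubspace_imp_subspace assms)

lemma funpow_invariant:
  assumes "invariant_closed_subspace S M" "x \<in> M"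
  shows "(cblinfun_apply S ^^ n) x \<in> M"
  using assms by (induction n) (auto simp: invariant_closed_subspace_def)

text \<open>
Since the kernel of \<open>S\<close> on \<open>M\<close> lies in the hyper-range \<open>R\<close>, every preimage of a point of \<open>R\<close>
again belongs to \<open>R\<close>: two preimages under \<open>S\<close> differ by a kernel element. Hence a kernel vector is the
start of an infinite backward orbit, whose norms the open mapping theorem keeps geometrically
bounded, and the eigenvector chain lemma applies.
\<close>

lemma semi_regular_SVEP_inj:
  fixes T :: "'a::complex_banach \<Rightarrow>\<^sub>C\<^sub>L 'a" and l :: complex
  defines "S \<equiv> T - l *\<^sub>C id_cblinfun"
  assumes svep: "SVEP T" and M: "invariant_closed_subspace S M" and sr: "semi_regular_on S M"
    and x: "x \<in> M" "S x = 0"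
  shows "x = 0"
proof -
  have cM: "complex_vector.subspace M" "closed M" and inv: "S ` M \<subseteq> M"
    using M by (auto simp: invariant_closed_subspace_def)
  have ker: "y \<in> (cblinfun_apply S ^^ n) ` M" if "y \<in> M" "S y = 0" for y n
    using sr that unfolding semi_regular_on_def by blast
  obtain K where K: "K > 0" "\<And>x. x \<in> M \<Longrightarrow> \<exists>u\<in>M. S u = S x \<and> norm u \<le> K * norm (S x)"
    using open_mapping_cblinfun[OF cM closed_image_of_semi_regular[OF M sr]] by blast
  define R where "R = (\<Inter>n. (cblinfun_apply S ^^ n) ` M)"
  have "\<exists>u\<in>R. S u = y \<and> norm u \<le> K * norm y" if y: "y \<in> R" for y
  proof -
    have pre: "\<exists>w\<in>M. y = S ((cblinfun_apply S ^^ n) w)" for n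
    proof -
      have "y \<in> (cblinfun_apply S ^^ Suc n) ` M" using y unfolding R_def by blast
      then show ?thesis by auto
    qed
    then obtain u where u: "u \<in> M" "S u = y" "norm u \<le> K * norm y"
      using K(2) by (metis funpow_0)
    have "u \<in> (cblinfun_apply S ^^ n) ` M" for n
    proof -
      obtain w where w: "w \<in> M" "y = S ((cblinfun_apply S ^^ n) w)" using pre by blast
      have "u - (cblinfun_apply S ^^ n) w \<in> (cblinfun_apply S ^^ n) ` M"
        using u w funpow_invariant[OF M w(1)] subspace_diff[OF csubspace_imp_subspace[OF cM(1)]]
        by (intro ker) (auto simp: cblinfun_diff)
      from subspace_add[OF subspace_funpow_image[OF cM(1)] this imageI[OF w(1)]]
      show ?thesis by simp
    qed
    then show ?thesis using u unfolding R_def by blast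
  qed
  then obtain g where g: "\<And>y. y \<in> R \<Longrightarrow> g y \<in> R \<and> S (g y) = y \<and> norm (g y) \<le> K * norm y" by metis
  define X where "X n = (g ^^ n) x" for n
  have X0: "X 0 = x" and XS: "X (Suc n) = g (X n)" for n by (simp_all add: X_def)
  have "x \<in> R" using ker[OF x] by (simp add: R_def)
  then have XR: "X n \<in> R" for n by (induction n) (simp_all add: X0 XS g)
  have "X 0 = 0"
  proof (rule SVEP_eigenvector_chain[OF svep])
    show "T (X 0) = l *\<^sub>C X 0" using x(2) by (simp add: X0 S_def shift_op_apply)
    show "T (X (Suc n)) - l *\<^sub>C X (Suc n) = X n" for n
      using g[OF XR, of n] by (simp add: XS S_def shift_op_apply)
    show "norm (X n) \<le> norm x * K ^ n" for n
    proof (induction n)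
      case (Suc n)
      have "norm (X (Suc n)) \<le> K * norm (X n)" using g[OF XR] by (simp add: XS)
      also have "\<dots> \<le> K * (norm x * K ^ n)" using Suc K(1) by (intro mult_left_mono) auto
      finally show ?case by (simp add: mult_ac)
    qed (simp add: X0)
  qed
  then show ?thesis by (simp add: X0)
qed

text \<open>
Boundedness of the projection comes from the open mapping theorem for the addition map on
\<open>M \<times> N\<close>.
\<close>

lemma complement_projection:
  fixes M N :: "'a::complex_banach set"
  assumes M: "complex_vector.subspace M" "closed M" and N: "complex_vector.subspace N" "closed N"
    and disj: "M \<inter> N = {0}" and sum: "\<forall>z. \<exists>x\<in>M. \<exists>y\<in>N. z = x + y"
  obtains P :: "'a \<Rightarrow>\<^sub>C\<^sub>L 'a" where "\<And>x. x \<in> M \<Longrightarrow> P x = x" "\<And>y. y \<in> N \<Longrightarrow> P y = 0"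
    "\<And>z. P z \<in> M" "\<And>z. z - P z \<in> N"
proof -
  have rM: "subspace M" and rN: "subspace N" using M N by (auto intro: csubspace_imp_subspace)
  obtain p where p: "\<And>z. p z \<in> M" "\<And>z. z - p z \<in> N"
  proof -
    have "\<exists>x. x \<in> M \<and> z - x \<in> N" for z using sum by (metis add_diff_cancel_left')
    then show ?thesis using that by metis
  qed
  have uniq: "p z = x" if "x \<in> M" "z - x \<in> N" for x z
  proof -
    have "p z - x \<in> M" using p that subspace_diff[OF rM] by blast
    moreover have "(z - x) - (z - p z) \<in> N" using p that subspace_diff[OF rN] by blast
    ultimately have "p z - x \<in> M \<inter> N" by simp
    with disj show ?thesis by auto
  qed
  have padd: "p (x + y) = p x + p y" for x y
  proof (rule uniq)
    show "p x + p y \<in> M" using p subspace_add[OF rM] by blast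
    show "x + y - (p x + p y) \<in> N" using subspace_add[OF rN p(2)[of x] p(2)[of y]] by (simp add: algebra_simps)
  qed
  have pC: "p (c *\<^sub>C x) = c *\<^sub>C p x" for c x
    using complex_vector.subspace_scale[OF M(1) p(1)] complex_vector.subspace_scale[OF N(1) p(2)]
    by (intro uniq) (simp_all flip: scaleC.diff_right)
  have "\<exists>K. \<forall>z. norm (p z) \<le> norm z * K"
  proof -
    let ?s = "\<lambda>v::'a \<times> 'a. fst v + snd v"
    have "?s ` (M \<times> N) = UNIV" using sum by force
    moreover have "bounded_linear ?s" by (intro bounded_linear_intros)
    ultimately obtain K where K: "\<And>z. \<exists>v\<in>M \<times> N. ?s v = z \<and> norm v \<le> K * norm z"
      using open_mapping_bound[of ?s "M \<times> N"] subspace_Times[OF rM rN] closed_Times[OF M(2) N(2)]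
      by (metis UNIV_I closed_UNIV)
    have "norm (p z) \<le> norm z * K" for z
    proof -
      obtain x y where xy: "x \<in> M" "y \<in> N" "x + y = z" "norm (x, y) \<le> K * norm z" using K[of z] by auto
      then have "p z = x" by (intro uniq) auto
      moreover have "norm x \<le> norm (x, y)" by (rule norm_fst_le)
      ultimately show ?thesis using xy by (simp add: mult.commute)
    qed
    then show ?thesis by blast
  qed
  then obtain K where K: "\<And>z. norm (p z) \<le> norm z * K" by blast
  have "bounded_linear p"
    by (rule bounded_linear_intro[OF padd _ K]) (simp add: pC flip: scaleC_of_real)
  then have app: "cblinfun_apply (CBlinfun p) = p"
    by (simp add: CBlinfun_inverse bounded_clinear_iff pC)
  show thesis
  proof (rule that[of "CBlinfun p"])
    show "CBlinfun p x = x" if "x \<in> M" for x using that subspace_0[OF rN] by (simp add: app uniq)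
    show "CBlinfun p y = 0" if "y \<in> N" for y using that subspace_0[OF rM] by (simp add: app uniq)
  qed (simp_all add: app p)
qed

text \<open>
On the span of \<open>F\<close> and \<open>x\<close> the coefficient of \<open>x\<close> is bounded by \<open>1 / d\<close>, where \<open>d > 0\<close> is the
distance of \<open>x\<close> from \<open>F\<close>.
\<close>

lemma Hahn_Banach_separate_point:
  fixes F :: "'a::complex_normed_vector set"
  assumes F: "complex_vector.subspace F" "closed F" and x: "x \<notin> F"
  obtains \<phi> :: "'a cdual" where "\<And>y. y \<in> F \<Longrightarrow> \<phi> y = 0" "\<phi> x = 1"
proof -
  define d where "d = infdist x F"
  have ne: "F \<noteq> {}" using complex_vector.subspace_0[OF F(1)] by blast
  have d: "d > 0" using x F ne in_closed_iff_infdist_zero[OF F(2) ne] infdist_nonneg[of x F]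
    by (auto simp: d_def less_le)
  define G where "G = {(y + c *\<^sub>C x, c) |y c. y \<in> F}"
  have "complex_vector.subspace G"
  proof (rule complex_vector.subspaceI)
    show "0 \<in> G" using complex_vector.subspace_0[OF F(1)]
      by (auto simp: G_def zero_prod_def intro!: exI[of _ "0::'a"])
    show "u + v \<in> G" if uv: "u \<in> G" "v \<in> G" for u v
    proof -
      obtain y1 c1 y2 c2 where "u = (y1 + c1 *\<^sub>C x, c1)" "v = (y2 + c2 *\<^sub>C x, c2)" "y1 \<in> F" "y2 \<in> F"
        using uv by (auto simp: G_def)
      then have "u + v = ((y1 + y2) + (c1 + c2) *\<^sub>C x, c1 + c2)" "y1 + y2 \<in> F"
        using complex_vector.subspace_add[OF F(1)] by (auto simp: scaleC_add_left)
      then show ?thesis unfolding G_def by blast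
    qed
    show "a *\<^sub>C u \<in> G" if u: "u \<in> G" for a u
    proof -
      obtain y c where "u = (y + c *\<^sub>C x, c)" "y \<in> F" using u by (auto simp: G_def)
      then have "a *\<^sub>C u = (a *\<^sub>C y + (a * c) *\<^sub>C x, a * c)" "a *\<^sub>C y \<in> F"
        using complex_vector.subspace_scale[OF F(1)]
        by (auto simp: scaleC_add_right scaleC_prod_def scaleC_complex_def scaleC_scaleC)
      then show ?thesis unfolding G_def by blast
    qed
  qed
  moreover have "cmod c \<le> (1/d) * norm z" if zc: "(z, c) \<in> G" for z c
  proof (cases "c = 0")
    case False
    obtain y where y: "y \<in> F" "z = y + c *\<^sub>C x" using zc by (auto simp: G_def)
    have "(- 1 / c) *\<^sub>C y \<in> F" using y complex_vector.subspace_scale[OF F(1)] by blast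
    then have "d \<le> dist x ((- 1 / c) *\<^sub>C y)" unfolding d_def by (rule infdist_le)
    also have "\<dots> = norm ((1 / c) *\<^sub>C z)"
      using False y(2) scaleC.minus_left[of "1/c" y] by (simp add: dist_norm scaleC_add_right scaleC_scaleC add.commute)
    also have "\<dots> = norm z / cmod c" by (simp add: norm_scaleC norm_divide)
    finally show ?thesis using d False by (simp add: field_simps)
  qed (use d in simp)
  ultimately obtain \<phi> :: "'a cdual" where \<phi>: "\<And>z c. (z, c) \<in> G \<Longrightarrow> \<phi> z = c"
    using Hahn_Banach_complex[of G "1/d"] d by (metis less_eq_real_def zero_less_divide_1_iff)
  show thesis
  proof (rule that)
    show "\<phi> y = 0" if "y \<in> F" for y
      using that by (intro \<phi>) (auto simp: G_def intro!: exI[of _ y])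
    show "\<phi> x = 1"
      using complex_vector.subspace_0[OF F(1)] by (intro \<phi>) (auto simp: G_def intro!: exI[of _ "0::'a"])
  qed
qed

lemma shift_shift:
  "T - l *\<^sub>C id_cblinfun - w *\<^sub>C id_cblinfun = T - (l + w) *\<^sub>C (id_cblinfun :: 'a::complex_normed_vector \<Rightarrow>\<^sub>C\<^sub>L 'a)"
  by (simp add: scaleC_add_left)

lemma invariant_closed_subspace_shift:
  assumes "invariant_closed_subspace T M"
  shows "invariant_closed_subspace (T - z *\<^sub>C id_cblinfun) M"
proof -
  have "T x - z *\<^sub>C x \<in> M" if "x \<in> M" for x
    using assms that complex_vector.subspace_diff complex_vector.subspace_scale
    unfolding invariant_closed_subspace_def by blast
  then show ?thesis using assms by (auto simp: invariant_closed_subspace_def shift_op_apply)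
qed

text \<open>
This is the dual of the injectivity lemma. If \<open>S ` M\<close> is a proper subspace of \<open>M\<close>, a functional \<open>\<phi>0\<close>
annihilates \<open>S ` M\<close> and \<open>N\<close> but not \<open>M\<close>; it is an eigenvector of the adjoint. To continue it to a chain,
the next functional is prescribed on \<open>S ` M\<close> by \<open>S x \<mapsto> \<psi> x\<close> and extended by the Hahn-Banach theorem.
This prescription is consistent if \<open>\<psi>\<close> vanishes on the kernel of \<open>S\<close> on \<open>M\<close>, which is why the \<open>n\<close>-th functional
is required to vanish on the range of \<open>S ^^ Suc n\<close>: by semi-regularity that range contains the kernel.
Composing with the projection onto \<open>M\<close> keeps all functionals zero on \<open>N\<close>.
\<close>

lemma semi_regular_adjoint_SVEP_surj:
  fixes T :: "'a::complex_banach \<Rightarrow>\<^sub>C\<^sub>L 'a" and l :: complex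
  defines "S \<equiv> T - l *\<^sub>C id_cblinfun"
  assumes svep: "SVEP (adjoint_op T)"
    and M: "invariant_closed_subspace S M" and N: "invariant_closed_subspace S N"
    and disj: "M \<inter> N = {0}" and sum: "\<forall>z. \<exists>x\<in>M. \<exists>y\<in>N. z = x + y"
    and sr: "semi_regular_on S M"
  shows "S ` M = M"
proof (rule ccontr)
  have cM: "complex_vector.subspace M" "closed M" and invM: "S ` M \<subseteq> M"
    and cN: "complex_vector.subspace N" "closed N" and invN: "S ` N \<subseteq> N"
    using M N by (auto simp: invariant_closed_subspace_def)
  obtain P :: "'a \<Rightarrow>\<^sub>C\<^sub>L 'a" where PM: "\<And>x. x \<in> M \<Longrightarrow> P x = x" and PN: "\<And>y. y \<in> N \<Longrightarrow> P y = 0"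
    using complement_projection[OF cM cN disj sum] by metis
  have clS: "closed (S ` M)" using closed_image_of_semi_regular[OF M sr] .
  obtain K where K: "K > 0" "\<And>x. x \<in> M \<Longrightarrow> \<exists>u\<in>M. S u = S x \<and> norm u \<le> K * norm (S x)"
    using open_mapping_cblinfun[OF cM clS] by blast
  have subS: "complex_vector.subspace (S ` M)"
  proof (rule complex_vector.subspaceI)
    show "0 \<in> S ` M" using complex_vector.subspace_0[OF cM(1)] cblinfun_zero by (metis imageI)
    show "x + y \<in> S ` M" if "x \<in> S ` M" "y \<in> S ` M" for x y
      using that complex_vector.subspace_add[OF cM(1)] by (auto simp flip: cblinfun_add)
    show "c *\<^sub>C x \<in> S ` M" if "x \<in> S ` M" for c x
      using that complex_vector.subspace_scale[OF cM(1)] by (auto simp flip: cblinfun_apply_scaleC)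
  qed
  assume "S ` M \<noteq> M"
  then obtain x1 where x1: "x1 \<in> M" "x1 \<notin> S ` M" using invM by blast
  obtain \<phi> :: "'a cdual" where \<phi>: "\<And>y. y \<in> S ` M \<Longrightarrow> \<phi> y = 0" "\<phi> x1 = 1"
    using Hahn_Banach_separate_point[OF subS clS x1(2)] by blast
  define \<phi>0 where "\<phi>0 = adjoint_op P \<phi>"
  define good where "good n \<psi> \<longleftrightarrow> (\<forall>y\<in>N. \<psi> y = 0) \<and> (\<forall>x\<in>M. \<psi> ((cblinfun_apply S ^^ Suc n) x) = 0)"
    for n and \<psi> :: "'a cdual"
  define next_in_chain where "next_in_chain \<psi> \<psi>' \<longleftrightarrow> (\<forall>x. \<psi>' (S x) = \<psi> x) \<and> norm \<psi>' \<le> norm P * K * norm \<psi>"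
    for \<psi> \<psi>' :: "'a cdual"
  have P0: "good 0 \<phi>0"
    using \<phi> PN PM invM by (auto simp: good_def \<phi>0_def adjoint_op_apply cblinfun_zero)
  have step: "\<exists>\<psi>'. good (Suc n) \<psi>' \<and> next_in_chain \<psi> \<psi>'" if g: "good n \<psi>" for n \<psi>
  proof -
    define G where "G = (\<lambda>x. (S x, \<psi> x)) ` M"
    have "complex_vector.subspace G"
    proof (rule complex_vector.subspaceI)
      show "0 \<in> G" unfolding G_def
        using complex_vector.subspace_0[OF cM(1)] by (force simp: zero_prod_def cblinfun_zero)
      show "x + y \<in> G" if "x \<in> G" "y \<in> G" for x y
        using that complex_vector.subspace_add[OF cM(1)] by (auto simp: G_def simp flip: cblinfun_add)
      show "c *\<^sub>C x \<in> G" if "x \<in> G" for c x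
        using that complex_vector.subspace_scale[OF cM(1)]
        by (auto simp: G_def scaleC_prod_def simp flip: cblinfun_apply_scaleC)
    qed
    moreover have "cmod a \<le> (norm \<psi> * K) * norm y" if ya: "(y, a) \<in> G" for y a
    proof -
      obtain x where x: "x \<in> M" "y = S x" "a = \<psi> x" using ya by (auto simp: G_def)
      obtain u where u: "u \<in> M" "S u = S x" "norm u \<le> K * norm (S x)" using K(2)[OF x(1)] by blast
      have "x - u \<in> M" "S (x - u) = 0"
        using x u complex_vector.subspace_diff[OF cM(1)] by (auto simp: cblinfun_diff)
      then have "x - u \<in> (\<Inter>n. (cblinfun_apply S ^^ n) ` M)"
        using sr unfolding semi_regular_on_def by blast
      then obtain w where "w \<in> M" "x - u = (cblinfun_apply S ^^ Suc n) w" by blast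
      then have "\<psi> (x - u) = 0" using g unfolding good_def by metis
      then have "cmod a = cmod (\<psi> u)" by (simp add: x cblinfun_diff)
      also have "\<dots> \<le> norm \<psi> * norm u" by (rule norm_cblinfun)
      also have "\<dots> \<le> norm \<psi> * (K * norm y)" using u x by (intro mult_left_mono) auto
      finally show ?thesis by simp
    qed
    ultimately obtain \<psi>0 :: "'a cdual" where \<psi>0: "\<And>y a. (y, a) \<in> G \<Longrightarrow> \<psi>0 y = a"
      "\<And>y. cmod (\<psi>0 y) \<le> (norm \<psi> * K) * norm y"
      using Hahn_Banach_complex[of G "norm \<psi> * K"] K(1) by (metis less_imp_le mult_nonneg_nonneg norm_ge_zero)
    define \<psi>' where "\<psi>' = adjoint_op P \<psi>0"
    have \<psi>'S: "\<psi>' (S x) = \<psi> x" if x: "x \<in> M" for x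
    proof -
      have "S x \<in> M" using x invM by blast
      then have "\<psi>' (S x) = \<psi>0 (S x)" by (simp add: \<psi>'_def adjoint_op_apply PM)
      also have "\<dots> = \<psi> x" by (rule \<psi>0(1)) (use x in \<open>simp add: G_def\<close>)
      finally show ?thesis .
    qed
    have \<psi>'N: "\<psi>' y = 0" if "y \<in> N" for y
      using that by (simp add: \<psi>'_def adjoint_op_apply PN cblinfun_zero)
    have "good (Suc n) \<psi>'"
      using \<psi>'N \<psi>'S g funpow_invariant[OF M, of _ "Suc n"] unfolding good_def by simp
    moreover have "\<psi>' (S x) = \<psi> x" for x
    proof -
      obtain u v where uv: "u \<in> M" "v \<in> N" "x = u + v" using sum by blast
      then have "\<psi>' (S v) = 0" "\<psi> v = 0" using \<psi>'N invN g unfolding good_def by auto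
      then show ?thesis using uv \<psi>'S by (simp add: cblinfun_add)
    qed
    moreover have "norm \<psi>' \<le> norm P * K * norm \<psi>"
    proof (rule norm_cblinfun_bound)
      show "norm (\<psi>' x) \<le> norm P * K * norm \<psi> * norm x" for x
      proof -
        have "norm (\<psi>' x) \<le> (norm \<psi> * K) * norm (P x)"
          using \<psi>0(2) by (simp add: \<psi>'_def adjoint_op_apply)
        also have "\<dots> \<le> (norm \<psi> * K) * (norm P * norm x)"
          using K(1) by (intro mult_left_mono norm_cblinfun) auto
        finally show ?thesis by (simp add: mult_ac)
      qed
    qed (use K in auto)
    ultimately show ?thesis unfolding next_in_chain_def by blast
  qed
  have "\<exists>F. \<forall>n. good n (F n) \<and> next_in_chain (F n) (F (Suc n)) \<and> (n = 0 \<longrightarrow> F n = \<phi>0)"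
  proof -
    have "\<exists>F. \<forall>n. (good n (F n) \<and> (n = 0 \<longrightarrow> F n = \<phi>0)) \<and> next_in_chain (F n) (F (Suc n))"
      by (rule dependent_nat_choice) (use P0 step in auto)
    then show ?thesis by blast
  qed
  then obtain F where F: "\<And>n. next_in_chain (F n) (F (Suc n))" "F 0 = \<phi>0" by blast
  have adj: "cblinfun_apply (adjoint_op T) \<psi> - l *\<^sub>C \<psi> = \<psi>'" if "\<And>x. \<psi> (S x) = \<psi>' x" for \<psi> \<psi>' :: "'a cdual"
  proof (rule cblinfun_eqI)
    fix x
    have "S x = T x - l *\<^sub>C x" by (simp only: S_def shift_op_apply)
    then have "cblinfun_apply (cblinfun_apply (adjoint_op T) \<psi> - l *\<^sub>C \<psi>) x = \<psi> (S x)"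
      by (simp only: minus_cblinfun.rep_eq scaleC_cblinfun.rep_eq adjoint_op_apply
          cblinfun_diff cblinfun_apply_scaleC)
    then show "cblinfun_apply (cblinfun_apply (adjoint_op T) \<psi> - l *\<^sub>C \<psi>) x = \<psi>' x" by (simp add: that)
  qed
  have "F 0 = 0"
  proof (rule SVEP_eigenvector_chain[OF svep])
    have "\<phi>0 (S x) = 0" for x
    proof -
      obtain u v where uv: "u \<in> M" "v \<in> N" "x = u + v" using sum by blast
      have "S u \<in> M" "S v \<in> N" using uv invM invN by auto
      then show ?thesis using uv \<phi>(1) PM PN
        by (simp add: \<phi>0_def adjoint_op_apply cblinfun_add cblinfun_zero)
    qed
    then have "cblinfun_apply (adjoint_op T) \<phi>0 - l *\<^sub>C \<phi>0 = 0"
      by (intro adj) (simp add: zero_cblinfun.rep_eq)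
    then show "cblinfun_apply (adjoint_op T) (F 0) = l *\<^sub>C F 0" by (simp add: F)
    show "cblinfun_apply (adjoint_op T) (F (Suc n)) - l *\<^sub>C F (Suc n) = F n" for n
      using F(1)[of n] unfolding next_in_chain_def by (intro adj) blast
    show "norm (F n) \<le> norm (F 0) * (norm P * K) ^ n" for n
    proof (induction n)
      case (Suc n)
      have "norm (F (Suc n)) \<le> (norm P * K) * norm (F n)"
        using F(1)[of n] unfolding next_in_chain_def by blast
      also have "\<dots> \<le> (norm P * K) * (norm (F 0) * (norm P * K) ^ n)"
        using Suc K(1) by (intro mult_left_mono) auto
      finally show ?case by (simp add: mult_ac)
    qed simp
  qed
  then have "\<phi>0 x1 = 0" by (simp add: F zero_cblinfun.rep_eq)
  then show False using \<phi>(2) PM[OF x1(1)] by (simp add: \<phi>0_def adjoint_op_apply)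
qed

lemma bij_betw_bounded_below:
  fixes S :: "'a::complex_banach \<Rightarrow>\<^sub>C\<^sub>L 'a"
  assumes M: "complex_vector.subspace M" "closed M" and bij: "bij_betw S M M"
  obtains K where "K > 0" "\<And>x. x \<in> M \<Longrightarrow> norm x \<le> K * norm (S x)"
proof -
  have "closed (S ` M)" using bij M by (simp add: bij_betw_def)
  then obtain K where K: "K > 0" "\<And>x. x \<in> M \<Longrightarrow> \<exists>u\<in>M. S u = S x \<and> norm u \<le> K * norm (S x)"
    using open_mapping_cblinfun[OF M] by blast
  then have "norm x \<le> K * norm (S x)" if "x \<in> M" for x
    using bij that unfolding bij_betw_def inj_on_def by metis
  with K(1) show thesis by (rule that)
qed

lemma invertible_on_iff_bij_betw:
  fixes S :: "'a::complex_banach \<Rightarrow>\<^sub>C\<^sub>L 'a"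
  assumes M: "complex_vector.subspace M" "closed M"
  shows "invertible_on S M \<longleftrightarrow> bij_betw S M M"
proof
  assume bij: "bij_betw S M M"
  obtain K where K: "\<And>x. x \<in> M \<Longrightarrow> norm x \<le> K * norm (S x)"
    using bij_betw_bounded_below[OF M bij] by blast
  have "norm (inv_into M S y) \<le> K * norm y" if "y \<in> M" for y
    using K[of "inv_into M S y"] bij that by (simp add: bij_betw_def f_inv_into_f inv_into_into)
  then show "invertible_on S M" using bij unfolding invertible_on_def by blast
qed (simp add: invertible_on_def)

text \<open>
Solving \<open>S x - z x = y\<close> amounts to a fixed point problem for \<open>x \<mapsto> g (y + z x)\<close> with \<open>g\<close> the inverse of
\<open>S\<close> on \<open>M\<close>, a contraction with factor at most one half.
\<close>

lemma bij_betw_shift_small: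
  fixes S :: "'a::complex_banach \<Rightarrow>\<^sub>C\<^sub>L 'a"
  assumes M: "invariant_closed_subspace S M" and bij: "bij_betw S M M"
    and K: "K > 0" "\<And>x. x \<in> M \<Longrightarrow> norm x \<le> K * norm (S x)" and z: "cmod z * K \<le> 1 / 2"
  shows "bij_betw (S - z *\<^sub>C id_cblinfun) M M"
    and "\<And>x. x \<in> M \<Longrightarrow> norm x \<le> 2 * K * norm ((S - z *\<^sub>C id_cblinfun) x)"
proof -
  have cM: "complex_vector.subspace M" "closed M"
    using M by (auto simp: invariant_closed_subspace_def)
  note sub = complex_vector.subspace_add[OF cM(1)] complex_vector.subspace_diff[OF cM(1)]
    complex_vector.subspace_scale[OF cM(1)]
  let ?S = "S - z *\<^sub>C id_cblinfun"
  show below: "norm x \<le> 2 * K * norm (?S x)" if "x \<in> M" for x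
  proof -
    have "norm x \<le> K * norm (S x)" by (rule K(2)[OF that])
    also have "\<dots> = K * norm (?S x + z *\<^sub>C x)" by (simp add: shift_op_apply)
    also have "\<dots> \<le> K * (norm (?S x) + cmod z * norm x)"
      using K(1) norm_triangle_ineq[of "?S x" "z *\<^sub>C x"] by (intro mult_left_mono) (auto simp: norm_scaleC)
    also have "\<dots> = K * norm (?S x) + (cmod z * K) * norm x" by (simp add: algebra_simps)
    also have "\<dots> \<le> K * norm (?S x) + (1/2) * norm x" using z by (intro add_left_mono mult_right_mono) auto
    finally show ?thesis by simp
  qed
  have "inj_on ?S M"
  proof (rule inj_onI)
    fix x y assume "x \<in> M" "y \<in> M" "?S x = ?S y"
    then show "x = y" using below[of "x - y"] sub by (simp add: cblinfun_diff)
  qed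
  moreover have "y \<in> ?S ` M" if y: "y \<in> M" for y
  proof -
    define g where "g = inv_into M S"
    have g: "g v \<in> M" "S (g v) = v" if "v \<in> M" for v
      using that bij by (simp_all add: g_def bij_betw_def f_inv_into_f inv_into_into)
    have "\<exists>!x. x \<in> M \<and> g (y + z *\<^sub>C x) = x"
    proof (rule Banach_fix[where c = "1/2"])
      show "complete M" using cM(2) by (simp add: complete_eq_closed)
      show "M \<noteq> {}" using y by blast
      show "(\<lambda>x. g (y + z *\<^sub>C x)) ` M \<subseteq> M"
        by (rule image_subsetI) (intro g(1) sub(1) sub(3) y)
      show "dist (g (y + z *\<^sub>C u)) (g (y + z *\<^sub>C v)) \<le> 1 / 2 * dist u v" if uv: "u \<in> M" "v \<in> M" for u v
      proof -
        have m: "y + z *\<^sub>C u \<in> M" "y + z *\<^sub>C v \<in> M" by (intro sub(1) sub(3) y uv)+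
        have "dist (g (y + z *\<^sub>C u)) (g (y + z *\<^sub>C v)) \<le> K * norm (S (g (y + z *\<^sub>C u) - g (y + z *\<^sub>C v)))"
          unfolding dist_norm by (intro K(2) sub(2) g(1) m)
        also have "\<dots> = K * norm (z *\<^sub>C (u - v))"
          using m by (simp add: cblinfun_diff g scaleC.diff_right)
        also have "\<dots> = (cmod z * K) * dist u v" by (simp add: norm_scaleC dist_norm)
        also have "\<dots> \<le> 1 / 2 * dist u v" using z by (intro mult_right_mono) auto
        finally show ?thesis .
      qed
    qed auto
    then obtain x where x: "x \<in> M" "g (y + z *\<^sub>C x) = x" by blast
    have "y + z *\<^sub>C x \<in> M" by (intro sub(1) sub(3) y x)
    then have "S x = y + z *\<^sub>C x" using g(2) x(2) by metis
    then show ?thesis using x by (intro image_eqI[of _ _ x]) (simp_all add: shift_op_apply)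
  qed
  moreover have "?S ` M \<subseteq> M"
    using invariant_closed_subspace_shift[OF M] by (simp add: invariant_closed_subspace_def)
  ultimately show "bij_betw ?S M M" unfolding bij_betw_def by blast
qed

lemma bij_of_complementary_bij:
  fixes S :: "'a::complex_banach \<Rightarrow>\<^sub>C\<^sub>L 'a"
  assumes M: "complex_vector.subspace M" and N: "complex_vector.subspace N"
    and disj: "M \<inter> N = {0}" and sum: "\<forall>z. \<exists>x\<in>M. \<exists>y\<in>N. z = x + y"
    and bM: "bij_betw S M M" and bN: "bij_betw S N N"
  shows "bij S"
proof (rule bijI)
  have ker: "x = 0" if "S x = 0" for x
  proof -
    obtain u v where uv: "u \<in> M" "v \<in> N" "x = u + v" using sum by blast
    then have eq: "S u = - S v" using that by (simp add: cblinfun_add add_eq_0_iff2)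
    have "S u \<in> M" "S v \<in> N" using uv bM bN by (auto simp: bij_betw_def)
    moreover have "S u \<in> N" unfolding eq by (rule complex_vector.subspace_neg[OF N]) fact
    ultimately have "S u = 0" using disj by blast
    moreover have "S v = 0" using eq calculation by simp
    ultimately have "u = 0" "v = 0"
      using inj_onD[OF bij_betw_imp_inj_on[OF bM], of u 0] inj_onD[OF bij_betw_imp_inj_on[OF bN], of v 0]
        uv complex_vector.subspace_0[OF M] complex_vector.subspace_0[OF N] by (simp_all add: cblinfun_zero)
    then show ?thesis using uv by simp
  qed
  show "inj S" by (rule injI) (metis cblinfun_diff eq_iff_diff_eq_0 ker)
  show "surj S"
  proof -
    have "\<exists>x. y = S x" for y
    proof -
      obtain u v where uv: "u \<in> M" "v \<in> N" "y = u + v" using sum by blast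
      then obtain u' v' where "u = S u'" "v = S v'" using bM bN unfolding bij_betw_def by blast
      then show ?thesis using uv by (metis cblinfun_add)
    qed
    then show ?thesis by (auto simp: surj_def)
  qed
qed

text \<open>
On the semi-regular summand both extension properties together force \<open>T - l\<close> to be bijective, which
persists for small shifts; on the quasinilpotent summand every nonzero shift is bijective. So \<open>T - z\<close> is
bijective for all \<open>z \<noteq> l\<close> close to \<open>l\<close>.
\<close>

lemma pseudo_fredholm_imp_not_islimpt:
  fixes T :: "'a::complex_banach \<Rightarrow>\<^sub>C\<^sub>L 'a"
  assumes svep: "SVEP T" "SVEP (adjoint_op T)" and pf: "pseudo_fredholm (T - l *\<^sub>C id_cblinfun)"
  shows "\<not> l islimpt spectrum_on T UNIV"
proof -
  let ?S = "T - l *\<^sub>C id_cblinfun"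
  obtain M N where M: "invariant_closed_subspace ?S M" and N: "invariant_closed_subspace ?S N"
    and disj: "M \<inter> N = {0}" and sum: "\<forall>z. \<exists>x\<in>M. \<exists>y\<in>N. z = x + y"
    and sr: "semi_regular_on ?S M" and qn: "quasinilpotent_on ?S N"
    using pf unfolding pseudo_fredholm_def by blast
  have cM: "complex_vector.subspace M" "closed M" and cN: "complex_vector.subspace N" "closed N"
    using M N by (auto simp: invariant_closed_subspace_def)
  have "inj_on ?S M"
  proof (rule inj_onI)
    fix x y assume xy: "x \<in> M" "y \<in> M" "?S x = ?S y"
    have "x - y = 0"
    proof (rule semi_regular_SVEP_inj[OF svep(1) M sr])
      show "x - y \<in> M" by (rule complex_vector.subspace_diff[OF cM(1) xy(1,2)])
      show "?S (x - y) = 0" using xy(3) by (simp only: cblinfun_diff diff_self)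
    qed
    then show "x = y" by simp
  qed
  then have bM: "bij_betw ?S M M"
    using semi_regular_adjoint_SVEP_surj[OF svep(2) M N disj sum sr] by (simp add: bij_betw_def)
  obtain K where K: "K > 0" "\<And>x. x \<in> M \<Longrightarrow> norm x \<le> K * norm (?S x)"
    using bij_betw_bounded_below[OF cM bM] by blast
  have "z \<notin> spectrum_on T UNIV" if z: "z \<noteq> l" "dist z l < 1 / (2 * K)" for z
  proof -
    have eq: "?S - (z - l) *\<^sub>C id_cblinfun = T - z *\<^sub>C id_cblinfun" by (simp add: shift_shift)
    have small: "cmod (z - l) * K \<le> 1 / 2" using z K(1) by (simp add: dist_norm field_simps)
    have "bij_betw (?S - (z - l) *\<^sub>C id_cblinfun) M M"
      by (rule bij_betw_shift_small(1)[OF M bM K(1) K(2) small])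
    then have "bij_betw (T - z *\<^sub>C id_cblinfun) M M" by (simp only: eq)
    moreover have "z - l \<noteq> 0" using z(1) by simp
    then have "z - l \<notin> spectrum_on ?S N"
      using qn unfolding quasinilpotent_on_def by blast
    then have "bij_betw (T - z *\<^sub>C id_cblinfun) N N"
      unfolding spectrum_on_def mem_Collect_eq not_not eq invertible_on_def by (rule conjunct1)
    ultimately have "bij (T - z *\<^sub>C id_cblinfun)"
      by (rule bij_of_complementary_bij[OF cM(1) cN(1) disj sum])
    then show ?thesis
      by (simp add: spectrum_on_def invertible_on_iff_bij_betw complex_vector.subspace_UNIV)
  qed
  moreover have "1 / (2 * K) > 0" using K(1) by simp
  ultimately show ?thesis unfolding islimpt_approachable by blast
qed

section \<open>Means of vector-valued functions over circles\<close>

definition on_circle :: "real \<Rightarrow> real \<Rightarrow> complex" where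
  "on_circle r t = of_real r * cis (2 * pi * t)"

lemma norm_on_circle: "r > 0 \<Longrightarrow> cmod (on_circle r t) = r"
  by (simp add: on_circle_def norm_mult)

lemma on_circle_nonzero: "r > 0 \<Longrightarrow> on_circle r t \<noteq> 0"
  by (simp add: on_circle_def)

lemma on_circle_vector_derivative:
  "(on_circle r has_vector_derivative (2 * pi * \<i> * on_circle r t)) (at t within A)"
  unfolding on_circle_def[abs_def] has_vector_derivative_def
  by (auto intro!: derivative_eq_intros ext simp: scaleR_conv_of_real mult_ac)

lemma continuous_on_on_circle [continuous_intros]:
  assumes "continuous_on A f" "continuous_on A g"
  shows "continuous_on A (\<lambda>x. on_circle (f x) (g x))"
  unfolding on_circle_def cis_conv_exp by (intro continuous_intros assms)

definition circle_mean :: "real \<Rightarrow> (complex \<Rightarrow> 'a::real_normed_vector) \<Rightarrow> 'a" where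
  "circle_mean r F = integral {0..1} (\<lambda>t. F (on_circle r t))"

lemma continuous_on_circle:
  assumes "continuous_on (sphere 0 r) F" "r > 0"
  shows "continuous_on {0..1} (\<lambda>t. F (on_circle r t))"
  by (rule continuous_on_compose2[OF assms(1)])
    (use assms(2) in \<open>auto intro!: continuous_intros simp: norm_on_circle\<close>)

lemma circle_mean_linear:
  assumes "continuous_on (sphere 0 r) F" "r > 0" "bounded_linear B"
  shows "circle_mean r (\<lambda>z. B (F z)) = B (circle_mean r (F :: complex \<Rightarrow> 'a::banach))"
  using integral_linear[OF integrable_continuous_real[OF continuous_on_circle[OF assms(1,2)]] assms(3)]
  by (simp add: circle_mean_def o_def)

lemma circle_mean_add:
  fixes F G :: "complex \<Rightarrow> 'a::banach"
  assumes "continuous_on (sphere 0 r) F" "continuous_on (sphere 0 r) G" "r > 0"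
  shows "circle_mean r (\<lambda>z. F z + G z) = circle_mean r F + circle_mean r G"
  unfolding circle_mean_def
  by (intro integral_add integrable_continuous_real continuous_on_circle assms)

lemma circle_mean_diff:
  fixes F G :: "complex \<Rightarrow> 'a::banach"
  assumes "continuous_on (sphere 0 r) F" "continuous_on (sphere 0 r) G" "r > 0"
  shows "circle_mean r (\<lambda>z. F z - G z) = circle_mean r F - circle_mean r G"
  unfolding circle_mean_def
  by (intro integral_diff integrable_continuous_real continuous_on_circle assms)

lemma circle_mean_cong:
  assumes "\<And>z. cmod z = r \<Longrightarrow> F z = G z" "r > 0"
  shows "circle_mean r F = circle_mean r G"
  unfolding circle_mean_def by (rule integral_cong) (simp add: assms norm_on_circle)

lemma norm_circle_mean_le:
  fixes F :: "complex \<Rightarrow> 'a::banach"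
  assumes "continuous_on (sphere 0 r) F" "r > 0" "\<And>z. cmod z = r \<Longrightarrow> norm (F z) \<le> K"
  shows "norm (circle_mean r F) \<le> K"
  using integral_bound[of 0 1 "\<lambda>t. F (on_circle r t)" K] continuous_on_circle[OF assms(1,2)] assms(2,3)
  by (simp add: circle_mean_def norm_on_circle)

lemma circle_mean_powi:
  assumes r: "r > 0"
  shows "circle_mean r (\<lambda>z. z powi k) = (if k = 0 then 1 else 0)"
proof (cases "k = 0")
  case False
  define c where "c = 2 * pi * \<i> * of_int k"
  have c: "c \<noteq> 0" using False by (simp add: c_def)
  let ?G = "\<lambda>t::real. of_real (r powi k) * cis (2 * pi * of_int k * t) / c"
  have "((\<lambda>t. on_circle r t powi k) has_integral (?G 1 - ?G 0)) {0..1}"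
  proof (rule fundamental_theorem_of_calculus)
    fix t :: real assume "t \<in> {0..1}"
    show "(?G has_vector_derivative on_circle r t powi k) (at t within {0..1})"
      unfolding has_vector_derivative_def
      using c by (auto intro!: derivative_eq_intros ext simp: on_circle_def power_int_mult_distrib
          cis_power_int scaleR_conv_of_real c_def of_real_power_int mult_ac)
  qed simp
  moreover have "cis (2 * pi * of_int k) = 1" by (rule cis_multiple_2pi) simp
  ultimately show ?thesis using False by (simp add: circle_mean_def integral_unique)
qed (simp add: circle_mean_def)

text \<open>
A form of Cauchy's theorem for the annulus. At each fixed radius, the derivative of \<open>F (r e^{it})\<close> in the radial direction is a
constant multiple of its derivative in the angular direction, and the latter integrates to zero over
a full period. The mean is thus a constant function of the radius.
\<close>

lemma circle_mean_independent_of_radius: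
  fixes F :: "complex \<Rightarrow> 'a::complex_banach"
  assumes deriv: "\<And>z. z \<in> ball 0 d - {0} \<Longrightarrow> (F has_derivative (\<lambda>h. h *\<^sub>C F' z)) (at z)"
    and cont: "continuous_on (ball 0 d - {0}) F'"
    and rs: "0 < r" "r < d" "0 < s" "s < d"
  shows "circle_mean r F = circle_mean s F"
proof -
  have mem: "on_circle x t \<in> ball 0 d - {0}" if "x \<in> {0<..<d}" for x t
    using that by (simp add: norm_on_circle on_circle_nonzero)
  let ?D = "\<lambda>x t. cis (2 * pi * t) *\<^sub>C F' (on_circle x t)"
  have contF: "continuous_on (ball 0 d - {0}) F"
    by (rule has_derivative_continuous_on[OF has_derivative_at_withinI[OF deriv]])
  have "((\<lambda>x. circle_mean x F) has_vector_derivative 0) (at x within {0<..<d})" if x: "x \<in> {0<..<d}" for x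
  proof -
    have "((\<lambda>x. integral (cbox 0 1) (\<lambda>t. F (on_circle x t))) has_vector_derivative
        integral (cbox 0 1) (?D x)) (at x within {0<..<d})"
    proof (rule leibniz_rule_vector_derivative)
      fix y t :: real assume y: "y \<in> {0<..<d}"
      have c: "((\<lambda>y. on_circle y t) has_derivative (\<lambda>h. of_real h * cis (2 * pi * t))) (at y within {0<..<d})"
        unfolding on_circle_def by (auto intro!: derivative_eq_intros)
      show "((\<lambda>y. F (on_circle y t)) has_vector_derivative ?D y t) (at y within {0<..<d})"
      proof -
        have "(of_real h * cis (2 * pi * t)) *\<^sub>C F' (on_circle y t) = h *\<^sub>R ?D y t" for h
          by (simp only: scaleC_of_real[symmetric] scaleC_scaleC)
        with has_derivative_compose[OF c deriv[OF mem[OF y]]] show ?thesis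
          by (simp only: has_vector_derivative_def)
      qed
      show "(\<lambda>t. F (on_circle y t)) integrable_on cbox 0 1"
        by (intro integrable_continuous continuous_on_compose2[OF contF] continuous_intros)
          (use mem[OF y] in auto)
    next
      have "continuous_on ({0<..<d} \<times> cbox 0 1) (\<lambda>p. ?D (fst p) (snd p))"
        unfolding cis_conv_exp
        by (intro scaleC.continuous_on continuous_on_compose2[OF cont] continuous_intros)
          (use mem in auto)
      then show "continuous_on ({0<..<d} \<times> cbox 0 1) (\<lambda>(x, t). ?D x t)"
        by (simp add: case_prod_unfold)
    qed (use x in auto)
    moreover have "integral {0..1} (?D x) = 0"
    proof -
      define c where "c = 2 * pi * \<i> * of_real x"
      have c: "c \<noteq> 0" using x by (simp add: c_def)
      have contD: "continuous_on {0..1} (?D x)"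
        unfolding cis_conv_exp
        by (intro scaleC.continuous_on continuous_on_compose2[OF cont] continuous_intros)
          (use mem[OF x] in auto)
      have "((\<lambda>t. c *\<^sub>C ?D x t) has_integral (F (on_circle x 1) - F (on_circle x 0))) {0..1}"
      proof (rule fundamental_theorem_of_calculus)
        fix t :: real
        have "((\<lambda>t. F (on_circle x t)) has_derivative
            (\<lambda>h. (h *\<^sub>R (2 * pi * \<i> * on_circle x t)) *\<^sub>C F' (on_circle x t))) (at t within {0..1})"
          by (rule has_derivative_compose[OF on_circle_vector_derivative[unfolded has_vector_derivative_def]
            deriv[OF mem[OF x]]])
        moreover have "(h *\<^sub>R (2 * pi * \<i> * on_circle x t)) *\<^sub>C F' (on_circle x t) = h *\<^sub>R (c *\<^sub>C ?D x t)" for h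
          unfolding scaleC.scaleR_left scaleC_scaleC c_def on_circle_def by (simp only: mult_ac)
        ultimately show "((\<lambda>t. F (on_circle x t)) has_vector_derivative c *\<^sub>C ?D x t) (at t within {0..1})"
          by (simp add: has_vector_derivative_def)
      qed simp
      then have "integral {0..1} (\<lambda>t. c *\<^sub>C ?D x t) = 0"
        by (simp add: integral_unique on_circle_def)
      moreover have "integral {0..1} (\<lambda>t. c *\<^sub>C ?D x t) = c *\<^sub>C integral {0..1} (?D x)"
        using integral_linear[OF integrable_continuous_real[OF contD] scaleC.bounded_linear_right[of c]]
        by (simp add: o_def)
      ultimately show ?thesis using c complex_vector.scale_eq_0_iff by metis
    qed
    ultimately show ?thesis by (simp add: circle_mean_def)
  qed
  then obtain c where "\<And>x. x \<in> {0<..<d} \<Longrightarrow> circle_mean x F = c"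
    using has_vector_derivative_zero_constant[of "{0<..<d}" "\<lambda>x. circle_mean x F"] by auto
  with rs show ?thesis by simp
qed

section \<open>The Riesz decomposition at an isolated point of the spectrum\<close>

lemma nonpos_if_le_geometric:
  fixes a c :: real
  assumes "\<And>n. a \<le> c * (1 / 2) ^ n"
  shows "a \<le> 0"
proof (rule LIMSEQ_le_const)
  show "(\<lambda>n. c * (1 / 2) ^ n) \<longlonglongrightarrow> 0"
    by (intro tendsto_mult_right_zero LIMSEQ_realpow_zero) auto
qed (use assms in blast)

text \<open>
Here \<open>S\<close> stands for \<open>T - l\<close> with \<open>l\<close> at worst an isolated point of the spectrum of \<open>T\<close>.
\<close>

locale isolated_spectral_zero =
  fixes S :: "'a::complex_banach \<Rightarrow>\<^sub>C\<^sub>L 'a" and d :: real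
  assumes d_pos: "d > 0"
    and bij_shift: "\<And>z. z \<in> ball 0 d - {0} \<Longrightarrow> bij (S - z *\<^sub>C id_cblinfun)"
begin

text \<open>
The sign convention is that of \<open>(z - S)^{-1}\<close>.
\<close>

definition resolvent :: "complex \<Rightarrow> 'a \<Rightarrow> 'a" where
  "resolvent z x = - inv (S - z *\<^sub>C id_cblinfun) x"

lemma resolvent_eq:
  assumes "z \<in> ball 0 d - {0}"
  shows "z *\<^sub>C resolvent z x - S (resolvent z x) = x"
proof -
  let ?u = "inv (S - z *\<^sub>C id_cblinfun) x"
  have "(S - z *\<^sub>C id_cblinfun) ?u = x" using bij_shift[OF assms] by (simp add: bij_is_surj surj_f_inv_f)
  then have "S ?u - z *\<^sub>C ?u = x" by (simp only: shift_op_apply)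
  then show ?thesis by (simp add: resolvent_def scaleC.minus_right cblinfun_minus)
qed

lemma resolvent_unique:
  assumes z: "z \<in> ball 0 d - {0}" and u: "z *\<^sub>C u - S u = x"
  shows "resolvent z x = u"
proof -
  have "(S - z *\<^sub>C id_cblinfun) (resolvent z x) = (S - z *\<^sub>C id_cblinfun) u"
    using resolvent_eq[OF z, of x] u unfolding shift_op_apply by (metis minus_diff_eq)
  then show ?thesis using bij_shift[OF z] by (meson bij_is_inj injD)
qed

lemma resolvent_add:
  assumes "z \<in> ball 0 d - {0}"
  shows "resolvent z (x + y) = resolvent z x + resolvent z y"
proof (rule resolvent_unique[OF assms])
  have "z *\<^sub>C (resolvent z x + resolvent z y) - S (resolvent z x + resolvent z y) =
      (z *\<^sub>C resolvent z x - S (resolvent z x)) + (z *\<^sub>C resolvent z y - S (resolvent z y))"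
    by (simp add: scaleC.add_right cblinfun_add)
  then show "z *\<^sub>C (resolvent z x + resolvent z y) - S (resolvent z x + resolvent z y) = x + y"
    by (simp only: resolvent_eq[OF assms])
qed

lemma resolvent_scaleC:
  assumes "z \<in> ball 0 d - {0}"
  shows "resolvent z (c *\<^sub>C x) = c *\<^sub>C resolvent z x"
proof (rule resolvent_unique[OF assms])
  have "z *\<^sub>C c *\<^sub>C resolvent z x - S (c *\<^sub>C resolvent z x) =
      c *\<^sub>C (z *\<^sub>C resolvent z x - S (resolvent z x))"
    by (simp only: scaleC.diff_right cblinfun_apply_scaleC scaleC_scaleC mult.commute)
  then show "z *\<^sub>C c *\<^sub>C resolvent z x - S (c *\<^sub>C resolvent z x) = c *\<^sub>C x"
    by (simp only: resolvent_eq[OF assms])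
qed

lemma resolvent_diff:
  assumes "z \<in> ball 0 d - {0}"
  shows "resolvent z (x - y) = resolvent z x - resolvent z y"
  using resolvent_add[OF assms, of "x - y" y] by simp

lemma resolvent_commute:
  assumes "z \<in> ball 0 d - {0}"
  shows "S (resolvent z x) = resolvent z (S x)"
proof (rule resolvent_unique[OF assms, symmetric])
  have "z *\<^sub>C S (resolvent z x) - S (S (resolvent z x)) = S (z *\<^sub>C resolvent z x - S (resolvent z x))"
    by (simp only: cblinfun_diff cblinfun_apply_scaleC)
  then show "z *\<^sub>C S (resolvent z x) - S (S (resolvent z x)) = S x"
    by (simp only: resolvent_eq[OF assms])
qed

lemma resolvent_identity:
  assumes z: "z \<in> ball 0 d - {0}" and w: "w \<in> ball 0 d - {0}"
  shows "resolvent w x - resolvent z x = (w - z) *\<^sub>C (- resolvent w (resolvent z x))"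
proof -
  have "resolvent w x = resolvent z x + (z - w) *\<^sub>C resolvent w (resolvent z x)"
  proof (rule resolvent_unique[OF w])
    let ?u = "resolvent z x" and ?v = "resolvent w (resolvent z x)"
    have "w *\<^sub>C (?u + (z - w) *\<^sub>C ?v) - S (?u + (z - w) *\<^sub>C ?v) =
        (w *\<^sub>C ?u - S ?u) + (z - w) *\<^sub>C (w *\<^sub>C ?v - S ?v)"
      by (simp only: scaleC.add_right scaleC.diff_right cblinfun_add cblinfun_apply_scaleC scaleC_scaleC mult.commute)
        (simp add: algebra_simps)
    also have "\<dots> = (w *\<^sub>C ?u - S ?u) + (z - w) *\<^sub>C ?u" by (simp only: resolvent_eq[OF w])
    also have "\<dots> = z *\<^sub>C ?u - S ?u" by (simp add: scaleC.diff_left)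
    also have "\<dots> = x" by (rule resolvent_eq[OF z])
    finally show "w *\<^sub>C (?u + (z - w) *\<^sub>C ?v) - S (?u + (z - w) *\<^sub>C ?v) = x" .
  qed
  moreover have "(z - w) *\<^sub>C v = (w - z) *\<^sub>C (- v)" for v :: 'a
    by (simp add: scaleC.diff_left scaleC.minus_right)
  ultimately show ?thesis by simp
qed

lemma resolvent_locally_bounded:
  assumes z: "z \<in> ball 0 d - {0}"
  obtains e K where "e > 0" "K > 0"
    "\<And>w x. w \<in> ball z e \<Longrightarrow> w \<in> ball 0 d - {0} \<Longrightarrow> norm (resolvent w x) \<le> K * norm x"
proof -
  let ?Sz = "S - z *\<^sub>C id_cblinfun"
  have U: "invariant_closed_subspace ?Sz UNIV"
    by (simp add: invariant_closed_subspace_def complex_vector.subspace_UNIV)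
  obtain K where K: "K > 0" "\<And>x. x \<in> UNIV \<Longrightarrow> norm x \<le> K * norm (?Sz x)"
    using bij_betw_bounded_below[OF complex_vector.subspace_UNIV closed_UNIV bij_shift[OF z]] by blast
  show thesis
  proof (rule that[of "1 / (2 * K)" "2 * K"])
    fix w x assume w: "w \<in> ball z (1 / (2 * K))" "w \<in> ball 0 d - {0}"
    have small: "cmod (w - z) * K \<le> 1 / 2"
      using w(1) K(1) by (simp add: dist_norm norm_minus_commute field_simps)
    have eq: "?Sz - (w - z) *\<^sub>C id_cblinfun = S - w *\<^sub>C id_cblinfun" by (simp add: shift_shift)
    have "norm (resolvent w x) \<le> 2 * K * norm ((?Sz - (w - z) *\<^sub>C id_cblinfun) (resolvent w x))"
      by (rule bij_betw_shift_small(2)[OF U bij_shift[OF z] K(1) K(2) small]) auto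
    also have "(?Sz - (w - z) *\<^sub>C id_cblinfun) (resolvent w x) = - x"
      unfolding eq shift_op_apply using resolvent_eq[OF w(2), of x] by (metis minus_diff_eq)
    finally show "norm (resolvent w x) \<le> 2 * K * norm x" by simp
  qed (use K in auto)
qed

text \<open>
The Laurent coefficients are handled vector by vector, as integrals in the space itself.
This uniform bound is what turns them into bounded operators.
\<close>

lemma resolvent_bounded_on_compact:
  assumes C: "compact C" "C \<subseteq> ball 0 d - {0}"
  obtains K where "K > 0" "\<And>z x. z \<in> C \<Longrightarrow> norm (resolvent z x) \<le> K * norm x"
proof -
  define bounded_near where "bounded_near z e K \<longleftrightarrow> e > 0 \<and> K > 0 \<and>
      (\<forall>w x. w \<in> ball z e \<longrightarrow> w \<in> ball 0 d - {0} \<longrightarrow> norm (resolvent w x) \<le> K * norm x)"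
    for z e K
  have "\<exists>e K. bounded_near z e K" if "z \<in> C" for z
  proof -
    have z: "z \<in> ball 0 d - {0}" using that C(2) by blast
    show ?thesis
    proof (rule resolvent_locally_bounded[OF z])
      fix e K :: real
      assume "e > 0" "K > 0"
        "\<And>w x. w \<in> ball z e \<Longrightarrow> w \<in> ball 0 d - {0} \<Longrightarrow> norm (resolvent w x) \<le> K * norm x"
      then have "bounded_near z e K" unfolding bounded_near_def by simp
      then show ?thesis by blast
    qed
  qed
  then obtain e K where "\<And>z. z \<in> C \<Longrightarrow> bounded_near z (e z) (K z)" by metis
  then have eK: "e z > 0" "K z > 0"
    "w \<in> ball z (e z) \<Longrightarrow> w \<in> ball 0 d - {0} \<Longrightarrow> norm (resolvent w x) \<le> K z * norm x"
    if "z \<in> C" for z w x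
    using that unfolding bounded_near_def by simp_all
  have "C \<subseteq> (\<Union>z\<in>C. ball z (e z))" using eK(1) by auto
  then obtain D where D: "D \<subseteq> C" "finite D" "C \<subseteq> (\<Union>z\<in>D. ball z (e z))"
    using compactE_image[OF C(1), of C "\<lambda>z. ball z (e z)"] by blast
  \<comment> \<open>The summand 1 keeps the bound positive when \<open>C\<close> is empty.\<close>
  define L where "L = 1 + (\<Sum>z\<in>D. K z)"
  have "(\<Sum>z\<in>D. K z) \<ge> 0" by (rule sum_nonneg) (use D(1) eK(2) in force)
  then have L: "L > 0" by (simp add: L_def)
  show thesis
  proof (rule that[OF L])
    fix w x assume w: "w \<in> C"
    then obtain z where z: "z \<in> D" "w \<in> ball z (e z)" using D by blast
    have "K z \<le> (\<Sum>z\<in>D. K z)" by (rule member_le_sum[OF z(1) _ D(2)]) (use D(1) eK(2) in force)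
    then have "K z \<le> L" by (simp add: L_def)
    moreover have "norm (resolvent w x) \<le> K z * norm x"
    proof (rule eK(3))
      show "z \<in> C" using z(1) D(1) by blast
      show "w \<in> ball 0 d - {0}" using w C(2) by blast
    qed (rule z(2))
    ultimately show "norm (resolvent w x) \<le> L * norm x"
      by (meson mult_right_mono norm_ge_zero order_trans)
  qed
qed

text \<open>
The argument of the resolvent is allowed to depend on \<open>w\<close>, so that continuity of iterated
resolvents, and hence of the derivative of the resolvent, is a special case.
\<close>

lemma resolvent_tendsto:
  assumes z: "z \<in> ball 0 d - {0}" and g: "isCont g z"
  shows "isCont (\<lambda>w. resolvent w (g w)) z"
proof -
  obtain e K where e: "e > 0" "K > 0"
    "\<And>w x. w \<in> ball z e \<Longrightarrow> w \<in> ball 0 d - {0} \<Longrightarrow> norm (resolvent w x) \<le> K * norm x"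
    using resolvent_locally_bounded[OF z] by blast
  have ev: "\<forall>\<^sub>F w in at z. w \<in> ball z e \<inter> (ball 0 d - {0})"
    by (rule eventually_at_in_open') (use z e in auto)
  have "((\<lambda>w. resolvent w (g w) - resolvent z (g z)) \<longlongrightarrow> 0) (at z)"
  proof (rule Lim_null_comparison)
    show "\<forall>\<^sub>F w in at z. norm (resolvent w (g w) - resolvent z (g z)) \<le>
        K * norm (g w - g z) + norm (w - z) * (K * norm (resolvent z (g z)))"
      using ev
    proof (rule eventually_mono)
      fix w assume "w \<in> ball z e \<inter> (ball 0 d - {0})"
      then have w: "w \<in> ball z e" "w \<in> ball 0 d - {0}" by auto
      have "resolvent w (g w) - resolvent z (g z) =
          resolvent w (g w - g z) + (resolvent w (g z) - resolvent z (g z))"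
        by (simp add: resolvent_diff[OF w(2)])
      also have "\<dots> = resolvent w (g w - g z) + (w - z) *\<^sub>C (- resolvent w (resolvent z (g z)))"
        by (simp only: resolvent_identity[OF z w(2)])
      also have "norm \<dots> \<le> norm (resolvent w (g w - g z)) + norm (w - z) * norm (resolvent w (resolvent z (g z)))"
        by (rule order_trans[OF norm_triangle_ineq]) (simp add: norm_scaleC)
      also have "\<dots> \<le> K * norm (g w - g z) + norm (w - z) * (K * norm (resolvent z (g z)))"
        by (intro add_mono mult_left_mono e(3) w) simp
      finally show "norm (resolvent w (g w) - resolvent z (g z)) \<le>
        K * norm (g w - g z) + norm (w - z) * (K * norm (resolvent z (g z)))" .
    qed
    have "((\<lambda>w. K * norm (g w - g z) + norm (w - z) * (K * norm (resolvent z (g z)))) \<longlongrightarrow>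
        K * norm (g z - g z) + norm (z - z) * (K * norm (resolvent z (g z)))) (at z)"
      using g unfolding isCont_def by (intro tendsto_intros)
    then show "((\<lambda>w. K * norm (g w - g z) + norm (w - z) * (K * norm (resolvent z (g z)))) \<longlongrightarrow> 0) (at z)"
      by simp
  qed
  then show ?thesis unfolding isCont_def by (simp add: LIM_zero_iff)
qed

lemma resolvent_has_derivative:
  assumes z: "z \<in> ball 0 d - {0}"
  shows "((\<lambda>w. resolvent w x) has_derivative (\<lambda>h. h *\<^sub>C (- resolvent z (resolvent z x)))) (at z)"
  unfolding has_derivative_iff_norm
proof
  let ?q = "\<lambda>w. - resolvent w (resolvent z x)"
  show "bounded_linear (\<lambda>h. h *\<^sub>C ?q z)" by (rule scaleC.bounded_linear_left)
  have "\<forall>\<^sub>F w in at z. w \<in> ball 0 d - {0}" 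
    by (rule eventually_at_in_open') (use z in auto)
  then have eq: "\<forall>\<^sub>F w in at z. norm (?q w - ?q z) =
      norm (resolvent w x - resolvent z x - (w - z) *\<^sub>C ?q z) / norm (w - z)"
    using eventually_neq_at_within[of z z UNIV]
  proof eventually_elim
    case (elim w)
    have "resolvent w x - resolvent z x - (w - z) *\<^sub>C ?q z = (w - z) *\<^sub>C (?q w - ?q z)"
      by (simp only: resolvent_identity[OF z elim(1)] scaleC.diff_right)
    then show ?case using elim(2) by (simp only: norm_scaleC) simp
  qed
  have "isCont ?q z" using resolvent_tendsto[OF z continuous_const] by (rule continuous_minus)
  then have lim: "((\<lambda>w. norm (?q w - ?q z)) \<longlongrightarrow> 0) (at z)"
    unfolding isCont_def by (intro tendsto_norm_zero LIM_zero)
  show "((\<lambda>w. norm (resolvent w x - resolvent z x - (w - z) *\<^sub>C ?q z) / norm (w - z)) \<longlongrightarrow> 0) (at z)"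
    by (rule Lim_transform_eventually[OF lim eq])
qed

lemma continuous_on_resolvent:
  assumes "A \<subseteq> ball 0 d - {0}"
  shows "continuous_on A (\<lambda>z. resolvent z x)"
proof (intro continuous_at_imp_continuous_on ballI)
  fix z assume "z \<in> A"
  then show "isCont (\<lambda>z. resolvent z x) z"
    using assms by (intro resolvent_tendsto continuous_const) blast
qed

text \<open>
Since \<open>dz = 2 \<pi> \<i> z dt\<close> on the circle, this is the contour integral of \<open>z^(k - 1) (z - S)^{-1} x\<close>
divided by \<open>2 \<pi> \<i>\<close>. In particular \<open>k = 1\<close> gives the Riesz projection.
\<close>

definition laurent_coeff :: "int \<Rightarrow> real \<Rightarrow> 'a \<Rightarrow> 'a" where
  "laurent_coeff k r x = circle_mean r (\<lambda>z. z powi k *\<^sub>C resolvent z x)"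

lemma circle_subset: "0 < r \<Longrightarrow> r < d \<Longrightarrow> sphere 0 r \<subseteq> ball 0 d - {0::complex}"
  by auto

lemma continuous_on_laurent_integrand:
  assumes "0 < r" "r < d"
  shows "continuous_on (sphere 0 r) (\<lambda>z. z powi k *\<^sub>C resolvent z x)"
  by (intro scaleC.continuous_on continuous_on_resolvent continuous_intros circle_subset assms)
    (use assms in auto)

lemma laurent_coeff_add:
  assumes r: "0 < r" "r < d"
  shows "laurent_coeff k r (x + y) = laurent_coeff k r x + laurent_coeff k r y"
proof -
  have "laurent_coeff k r (x + y) = circle_mean r (\<lambda>z. z powi k *\<^sub>C resolvent z x + z powi k *\<^sub>C resolvent z y)"
    unfolding laurent_coeff_def
  proof (rule circle_mean_cong)
    fix z :: complex assume "cmod z = r"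
    then have "z \<in> ball 0 d - {0}" using r by auto
    then show "z powi k *\<^sub>C resolvent z (x + y) = z powi k *\<^sub>C resolvent z x + z powi k *\<^sub>C resolvent z y"
      by (simp only: resolvent_add scaleC.add_right)
  qed (rule r)
  also have "\<dots> = laurent_coeff k r x + laurent_coeff k r y"
    unfolding laurent_coeff_def by (intro circle_mean_add continuous_on_laurent_integrand r)
  finally show ?thesis .
qed

lemma laurent_coeff_commute_linear:
  assumes r: "0 < r" "r < d" and B: "bounded_linear B"
    and comm: "\<And>z x. z \<in> ball 0 d - {0} \<Longrightarrow> B (resolvent z x) = resolvent z (B x)"
    and scale: "\<And>c x. B (c *\<^sub>C x) = c *\<^sub>C B x"
  shows "B (laurent_coeff k r x) = laurent_coeff k r (B x)"
proof -
  have "B (laurent_coeff k r x) = circle_mean r (\<lambda>z. B (z powi k *\<^sub>C resolvent z x))"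
    unfolding laurent_coeff_def
    by (rule circle_mean_linear[OF continuous_on_laurent_integrand[OF r] r(1) B, symmetric])
  also have "\<dots> = laurent_coeff k r (B x)"
    unfolding laurent_coeff_def
  proof (rule circle_mean_cong)
    fix z assume "cmod z = r"
    then have "z \<in> ball 0 d - {0}" using r by auto
    then show "B (z powi k *\<^sub>C resolvent z x) = z powi k *\<^sub>C resolvent z (B x)" by (simp only: scale comm)
  qed (rule r)
  finally show ?thesis .
qed

lemma laurent_coeff_scaleC:
  assumes r: "0 < r" "r < d"
  shows "laurent_coeff k r (c *\<^sub>C x) = c *\<^sub>C laurent_coeff k r x"
  by (rule laurent_coeff_commute_linear[OF r scaleC.bounded_linear_right, symmetric])
    (simp_all add: resolvent_scaleC scaleC_scaleC mult.commute)

lemma laurent_coeff_commute: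
  assumes r: "0 < r" "r < d"
  shows "S (laurent_coeff k r x) = laurent_coeff k r (S x)"
  by (rule laurent_coeff_commute_linear[OF r cblinfun_apply_bounded_linear resolvent_commute cblinfun_apply_scaleC])

lemma laurent_coeff_bound:
  assumes r: "0 < r" "r < d"
  obtains K where "K > 0" "\<And>k x. norm (laurent_coeff k r x) \<le> r powi k * K * norm x"
proof -
  obtain K where K: "K > 0" "\<And>z x. z \<in> sphere 0 r \<Longrightarrow> norm (resolvent z x) \<le> K * norm x"
    using resolvent_bounded_on_compact[OF compact_sphere circle_subset[OF r]] by blast
  show thesis
  proof (rule that[OF K(1)])
    fix k x
    show "norm (laurent_coeff k r x) \<le> r powi k * K * norm x"
      unfolding laurent_coeff_def
    proof (rule norm_circle_mean_le[OF continuous_on_laurent_integrand[OF r] r(1)])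
      fix z assume z: "cmod z = r"
      have "norm (z powi k *\<^sub>C resolvent z x) = r powi k * norm (resolvent z x)"
        by (simp add: norm_scaleC norm_power_int z)
      also have "\<dots> \<le> r powi k * (K * norm x)"
        using K(2)[of z x] z r by (intro mult_left_mono) auto
      finally show "norm (z powi k *\<^sub>C resolvent z x) \<le> r powi k * K * norm x" by (simp add: mult.assoc)
    qed
  qed
qed

text \<open>
Multiplication by \<open>S\<close> raises the index, because \<open>S (z - S)^{-1} = z (z - S)^{-1} - 1\<close>, and the mean of
\<open>z powi k\<close> is nonzero only for \<open>k = 0\<close>. All algebra of the decomposition rests on this recursion.
\<close>

lemma laurent_coeff_shift:
  assumes r: "0 < r" "r < d"
  shows "S (laurent_coeff k r x) = laurent_coeff (k + 1) r x - (if k = 0 then x else 0)"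
proof -
  have "S (laurent_coeff k r x) = circle_mean r (\<lambda>z. S (z powi k *\<^sub>C resolvent z x))"
    unfolding laurent_coeff_def
    by (rule circle_mean_linear[OF continuous_on_laurent_integrand[OF r] r(1) cblinfun_apply_bounded_linear, symmetric])
  also have "\<dots> = circle_mean r (\<lambda>z. z powi (k + 1) *\<^sub>C resolvent z x - z powi k *\<^sub>C x)"
  proof (rule circle_mean_cong)
    fix z assume z: "cmod z = r"
    then have D: "z \<in> ball 0 d - {0}" using r by auto
    have "S (resolvent z x) = z *\<^sub>C resolvent z x - x" using resolvent_eq[OF D, of x] by (simp add: algebra_simps)
    then have "S (z powi k *\<^sub>C resolvent z x) = z powi k *\<^sub>C (z *\<^sub>C resolvent z x - x)"
      by (simp only: cblinfun_apply_scaleC)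
    also have "\<dots> = z powi (k + 1) *\<^sub>C resolvent z x - z powi k *\<^sub>C x"
      using D by (simp add: scaleC.diff_right scaleC_scaleC power_int_add_1)
    finally show "S (z powi k *\<^sub>C resolvent z x) = z powi (k + 1) *\<^sub>C resolvent z x - z powi k *\<^sub>C x" .
  qed (rule r)
  also have "\<dots> = laurent_coeff (k + 1) r x - circle_mean r (\<lambda>z. z powi k *\<^sub>C x)"
    unfolding laurent_coeff_def
    by (intro circle_mean_diff continuous_on_laurent_integrand r scaleC.continuous_on continuous_intros)
      (use r in auto)
  also have "circle_mean r (\<lambda>z. z powi k *\<^sub>C x) = circle_mean r (\<lambda>z. z powi k) *\<^sub>C x"
    by (intro circle_mean_linear[OF _ r(1) scaleC.bounded_linear_left] continuous_intros) (use r in auto)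
  also have "\<dots> = (if k = 0 then x else 0)"
    by (simp add: circle_mean_powi[OF r(1)] scaleC.zero_left)
  finally show ?thesis .
qed

lemma laurent_coeff_1_independent:
  assumes "0 < r" "r < d" "0 < s" "s < d"
  shows "laurent_coeff 1 r x = laurent_coeff 1 s x"
proof -
  let ?F' = "\<lambda>z. z *\<^sub>C (- resolvent z (resolvent z x)) + resolvent z x"
  have "((\<lambda>z. z *\<^sub>C resolvent z x) has_derivative (\<lambda>h. h *\<^sub>C ?F' z)) (at z)"
    if z: "z \<in> ball 0 d - {0}" for z
  proof -
    have "((\<lambda>z. z *\<^sub>C resolvent z x) has_derivative
        (\<lambda>h. z *\<^sub>C (h *\<^sub>C (- resolvent z (resolvent z x))) + h *\<^sub>C resolvent z x)) (at z)"
      by (intro scaleC.FDERIV has_derivative_ident resolvent_has_derivative z)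
    moreover have "z *\<^sub>C (h *\<^sub>C v) + h *\<^sub>C u = h *\<^sub>C (z *\<^sub>C v + u)" for h and u v :: 'a
      by (simp add: scaleC.add_right scaleC_scaleC mult.commute)
    ultimately show ?thesis by (simp only:)
  qed
  moreover have "continuous_on (ball 0 d - {0}) ?F'"
  proof (intro scaleC.continuous_on continuous_on_add continuous_on_minus continuous_on_id continuous_on_resolvent order_refl)
    show "continuous_on (ball 0 d - {0}) (\<lambda>z. resolvent z (resolvent z x))"
      by (intro continuous_at_imp_continuous_on ballI resolvent_tendsto continuous_const)
  qed
  ultimately have "circle_mean r (\<lambda>z. z *\<^sub>C resolvent z x) = circle_mean s (\<lambda>z. z *\<^sub>C resolvent z x)"
    by (rule circle_mean_independent_of_radius) (use assms in auto)
  then show ?thesis by (simp add: laurent_coeff_def)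
qed


definition riesz_projection :: "'a \<Rightarrow> 'a" where
  "riesz_projection = laurent_coeff 1 (d / 2)"

lemma half_radius: "0 < d / 2" "d / 2 < d"
  using d_pos by auto

lemma riesz_projection_eq:
  assumes "0 < r" "r < d"
  shows "riesz_projection x = laurent_coeff 1 r x"
  unfolding riesz_projection_def by (rule laurent_coeff_1_independent[OF half_radius assms])

lemma funpow_laurent_coeff_positive:
  assumes r: "0 < r" "r < d"
  shows "(cblinfun_apply S ^^ n) (laurent_coeff 1 r x) = laurent_coeff (int n + 1) r x"
  by (induction n) (simp_all add: laurent_coeff_shift[OF r])

lemma funpow_laurent_coeff_negative:
  assumes r: "0 < r" "r < d"
  shows "(cblinfun_apply S ^^ n) (laurent_coeff (- int n) r x) = laurent_coeff 0 r x"
proof (induction n)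
  case (Suc n)
  have "(cblinfun_apply S ^^ Suc n) (laurent_coeff (- int (Suc n)) r x) =
      (cblinfun_apply S ^^ n) (S (laurent_coeff (- int (Suc n)) r x))"
    by (simp only: funpow_Suc_right o_apply)
  also have "S (laurent_coeff (- int (Suc n)) r x) = laurent_coeff (- int n) r x"
    by (simp add: laurent_coeff_shift[OF r])
  finally show ?case by (simp only: Suc)
qed simp

lemma funpow_laurent_coeff_commute:
  assumes r: "0 < r" "r < d"
  shows "(cblinfun_apply S ^^ n) (laurent_coeff k r x) = laurent_coeff k r ((cblinfun_apply S ^^ n) x)"
  by (induction n) (simp_all add: laurent_coeff_commute[OF r])

lemma riesz_projection_commute: "S (riesz_projection x) = riesz_projection (S x)"
  unfolding riesz_projection_def by (rule laurent_coeff_commute[OF half_radius])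

text \<open>
The case \<open>k = 0\<close> of the recursion: the Laurent coefficient of index zero is, up to sign, an inverse of \<open>S\<close> modulo
the Riesz projection.
\<close>

lemma riesz_complement: "x - riesz_projection x = - S (laurent_coeff 0 (d / 2) x)"
  unfolding riesz_projection_def using laurent_coeff_shift[OF half_radius, of 0 x] by simp

lemma riesz_projection_add: "riesz_projection (x + y) = riesz_projection x + riesz_projection y"
  unfolding riesz_projection_def by (rule laurent_coeff_add[OF half_radius])

lemma riesz_projection_scaleC: "riesz_projection (c *\<^sub>C x) = c *\<^sub>C riesz_projection x"
  unfolding riesz_projection_def by (rule laurent_coeff_scaleC[OF half_radius])

lemma bounded_linear_riesz_projection: "bounded_linear riesz_projection"
proof -
  obtain K where K: "\<And>k x. norm (laurent_coeff k (d / 2) x) \<le> (d / 2) powi k * K * norm x"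
    using laurent_coeff_bound[OF half_radius] by blast
  show ?thesis
  proof (rule bounded_linear_intro[OF riesz_projection_add])
    show "riesz_projection (t *\<^sub>R x) = t *\<^sub>R riesz_projection x" for t x
      using riesz_projection_scaleC[of "of_real t" x] by (simp only: scaleC_of_real)
    show "norm (riesz_projection x) \<le> norm x * ((d / 2) powi 1 * K)" for x
      using K[of 1 x] unfolding riesz_projection_def by (simp only: mult.commute)
  qed
qed

text \<open>
Applying \<open>S ^^ n\<close> to the projection gives the Laurent coefficient of index \<open>n + 1\<close>, which is estimated on
the circle of radius \<open>r\<close>. As the projection does not depend on the radius, \<open>r\<close> may be chosen as small as desired.
\<close>

lemma funpow_riesz_projection_bound:
  assumes r: "0 < r" "r < d"
  obtains K where "K > 0"
    "\<And>n x. norm ((cblinfun_apply S ^^ n) (riesz_projection x)) \<le> K * r ^ n * norm x"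
proof -
  obtain K where K: "K > 0" "\<And>k x. norm (laurent_coeff k r x) \<le> r powi k * K * norm x"
    using laurent_coeff_bound[OF r] by blast
  show thesis
  proof (rule that[of "r * K"])
    fix n x
    have "norm ((cblinfun_apply S ^^ n) (riesz_projection x)) \<le> r powi (int n + 1) * K * norm x"
      unfolding riesz_projection_eq[OF r] funpow_laurent_coeff_positive[OF r] by (rule K)
    also have "r powi (int n + 1) = r * r ^ n" using r by (simp add: power_int_add_1)
    finally show "norm ((cblinfun_apply S ^^ n) (riesz_projection x)) \<le> r * K * r ^ n * norm x"
      by (simp add: mult_ac)
  qed (use K r in simp)
qed

text \<open>
No double integral is needed: with \<open>P\<close> the projection and \<open>A k\<close> the coefficients for the radius \<open>d / 2\<close>,
the recursion gives \<open>(1 - P) P = - A (- n) S^(n + 1) P\<close> for every \<open>n\<close>. The first factor is of order \<open>(d / 2)^(- n)\<close>,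
while the second, estimated on the smaller circle of radius \<open>d / 4\<close>, is of order \<open>(d / 4)^n\<close>. So the
product is zero.
\<close>

lemma riesz_projection_idem: "riesz_projection (riesz_projection x) = riesz_projection x"
proof -
  let ?P = "riesz_projection" and ?r = "d / 2" and ?s = "d / 4"
  let ?A = "\<lambda>k. laurent_coeff k ?r"
  have s: "0 < ?s" "?s < d" using d_pos by auto
  obtain K where K: "K > 0" "\<And>k x. norm (?A k x) \<le> ?r powi k * K * norm x"
    using laurent_coeff_bound[OF half_radius] by blast
  obtain L where L: "L > 0" "\<And>n x. norm ((cblinfun_apply S ^^ n) (?P x)) \<le> L * ?s ^ n * norm x"
    using funpow_riesz_projection_bound[OF s] by blast
  have "norm (?P x - ?P (?P x)) \<le> (K * L * ?s * norm x) * (1 / 2) ^ n" for n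
  proof -
    have "S (?A 0 (?P x)) = (cblinfun_apply S ^^ Suc n) (?A (- int n) (?P x))"
      by (simp only: funpow.simps o_apply funpow_laurent_coeff_negative[OF half_radius])
    also have "\<dots> = ?A (- int n) ((cblinfun_apply S ^^ Suc n) (?P x))"
      by (rule funpow_laurent_coeff_commute[OF half_radius])
    finally have "norm (?P x - ?P (?P x)) = norm (?A (- int n) ((cblinfun_apply S ^^ Suc n) (?P x)))"
      by (simp only: riesz_complement[of "?P x"] norm_minus_cancel)
    also have "\<dots> \<le> ?r powi (- int n) * K * norm ((cblinfun_apply S ^^ Suc n) (?P x))" by (rule K)
    also have "\<dots> \<le> ?r powi (- int n) * K * (L * ?s ^ Suc n * norm x)"
      using K(1) d_pos by (intro mult_left_mono L(2)) auto
    also have "\<dots> = (K * L * ?s * norm x) * (?r powi (- int n) * ?s ^ n)" by simp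
    also have "?r powi (- int n) * ?s ^ n = (inverse ?r * ?s) ^ n"
      by (simp only: power_int_minus power_int_of_nat power_mult_distrib power_inverse)
    also have "inverse ?r * ?s = 1 / 2" using d_pos by simp
    finally show ?thesis .
  qed
  then have "norm (?P x - ?P (?P x)) \<le> 0" by (rule nonpos_if_le_geometric)
  then show ?thesis by simp
qed

definition riesz_kernel :: "'a set" where "riesz_kernel = {x. riesz_projection x = 0}"
definition riesz_range :: "'a set" where "riesz_range = {x. riesz_projection x = x}"

lemma invariant_riesz_kernel: "invariant_closed_subspace S riesz_kernel"
proof -
  interpret P: bounded_linear riesz_projection by (rule bounded_linear_riesz_projection)
  have "closed riesz_kernel"
    unfolding riesz_kernel_def by (intro closed_Collect_eq P.continuous_on continuous_intros)
  moreover have "complex_vector.subspace riesz_kernel"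
    by (rule complex_vector.subspaceI)
      (simp_all add: riesz_kernel_def P.zero P.add riesz_projection_scaleC scaleC.zero_right)
  moreover have "S ` riesz_kernel \<subseteq> riesz_kernel"
    by (auto simp: riesz_kernel_def cblinfun_zero simp flip: riesz_projection_commute)
  ultimately show ?thesis by (simp add: invariant_closed_subspace_def)
qed

lemma invariant_riesz_range: "invariant_closed_subspace S riesz_range"
proof -
  interpret P: bounded_linear riesz_projection by (rule bounded_linear_riesz_projection)
  have "closed riesz_range"
    unfolding riesz_range_def by (intro closed_Collect_eq P.continuous_on continuous_intros)
  moreover have "complex_vector.subspace riesz_range"
    by (rule complex_vector.subspaceI)
      (simp_all add: riesz_range_def P.zero P.add riesz_projection_scaleC)
  moreover have "S ` riesz_range \<subseteq> riesz_range"
    by (auto simp: riesz_range_def simp flip: riesz_projection_commute)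
  ultimately show ?thesis by (simp add: invariant_closed_subspace_def)
qed

text \<open>
The coefficient of index zero provides a preimage, which is moved into the kernel of the projection by
subtracting its projection; this does not change its image, because \<open>S\<close> commutes with the projection.
\<close>

lemma bij_on_riesz_kernel: "bij_betw S riesz_kernel riesz_kernel"
proof -
  interpret P: bounded_linear riesz_projection by (rule bounded_linear_riesz_projection)
  let ?P = riesz_projection and ?A = "laurent_coeff 0 (d / 2)"
  have cM: "complex_vector.subspace riesz_kernel"
    using invariant_riesz_kernel by (simp add: invariant_closed_subspace_def)
  have "?A 0 = 0" using laurent_coeff_scaleC[OF half_radius, of 0 0 0] by (simp add: scaleC.zero_left)
  then have ker: "x = 0" if "x \<in> riesz_kernel" "S x = 0" for x
    using riesz_complement[of x] that by (simp add: riesz_kernel_def laurent_coeff_commute[OF half_radius])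
  have "inj_on S riesz_kernel"
  proof (rule inj_onI)
    fix x y assume xy: "x \<in> riesz_kernel" "y \<in> riesz_kernel" "S x = S y"
    have "x - y = 0"
    proof (rule ker)
      show "x - y \<in> riesz_kernel" by (rule complex_vector.subspace_diff[OF cM xy(1,2)])
      show "S (x - y) = 0" using xy(3) by (simp only: cblinfun_diff diff_self)
    qed
    then show "x = y" by simp
  qed
  moreover have "x \<in> S ` riesz_kernel" if x: "x \<in> riesz_kernel" for x
  proof -
    \<comment> \<open>A preimage of \<open>x\<close>, not yet in the kernel of the projection.\<close>
    define v where "v = - ?A x"
    have Sv: "S v = x" using riesz_complement[of x] x by (simp add: v_def cblinfun_minus riesz_kernel_def)
    have "v - ?P v \<in> riesz_kernel" by (simp add: riesz_kernel_def P.diff riesz_projection_idem)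
    moreover have "S (v - ?P v) = x"
      using x by (simp add: cblinfun_diff riesz_projection_commute Sv riesz_kernel_def)
    ultimately show ?thesis by (metis imageI)
  qed
  ultimately show ?thesis
    using invariant_riesz_kernel unfolding bij_betw_def invariant_closed_subspace_def by blast
qed

text \<open>
On the range of the projection the powers of \<open>S\<close> decay faster than every geometric sequence, so the Neumann series
of \<open>(z - S)^{-1}\<close> converges there for every \<open>z \<noteq> 0\<close>.
\<close>

lemma quasinilpotent_on_riesz_range: "quasinilpotent_on S riesz_range"
proof -
  have cN: "complex_vector.subspace riesz_range" "closed riesz_range"
    using invariant_riesz_range by (simp_all add: invariant_closed_subspace_def)
  have "bij_betw (S - z *\<^sub>C id_cblinfun) riesz_range riesz_range" if z: "z \<noteq> 0" for z
  proof -
    let ?Sz = "S - z *\<^sub>C id_cblinfun"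
    \<comment> \<open>Any radius below both \<open>cmod z\<close> and \<open>d\<close> works; this one makes the ratio of the series at most one half.\<close>
    define r where "r = min (cmod z) d / 2"
    have r: "0 < r" "r < d" and rz: "r / cmod z \<le> 1 / 2" using z d_pos by (auto simp: r_def field_simps)
    obtain K where K: "K > 0"
      "\<And>n x. norm ((cblinfun_apply S ^^ n) (riesz_projection x)) \<le> K * r ^ n * norm x"
      using funpow_riesz_projection_bound[OF r] by blast
    have bound: "norm (inverse z ^ n *\<^sub>C (cblinfun_apply S ^^ n) x) \<le> K * norm x * (1 / 2) ^ n"
      if "x \<in> riesz_range" for x n
    proof -
      have "norm (inverse z ^ n *\<^sub>C (cblinfun_apply S ^^ n) x) = inverse (cmod z) ^ n * norm ((cblinfun_apply S ^^ n) x)"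
        by (simp add: norm_scaleC norm_power norm_inverse)
      also have "\<dots> \<le> inverse (cmod z) ^ n * (K * r ^ n * norm x)"
        using K(2)[of n x] that by (intro mult_left_mono) (auto simp: riesz_range_def)
      also have "\<dots> = (K * norm x) * (r / cmod z) ^ n" by (simp add: field_simps)
      also have "\<dots> \<le> (K * norm x) * (1 / 2) ^ n"
        using K(1) r rz by (intro mult_left_mono power_mono) auto
      finally show ?thesis .
    qed
    have ker: "x = 0" if x: "x \<in> riesz_range" "?Sz x = 0" for x
    proof -
      have "S x = z *\<^sub>C x" using x(2) by (simp add: shift_op_apply)
      then have "(cblinfun_apply S ^^ n) x = z ^ n *\<^sub>C x" for n
        by (induction n) (simp_all add: cblinfun_apply_scaleC scaleC_scaleC mult.commute)
      then have "inverse z ^ n *\<^sub>C (cblinfun_apply S ^^ n) x = x" for n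
        using z by (simp add: scaleC_scaleC flip: power_mult_distrib)
      then have "norm x \<le> K * norm x * (1 / 2) ^ n" for n
        using bound[OF x(1), of n] by (simp only:)
      then have "norm x \<le> 0" by (rule nonpos_if_le_geometric)
      then show ?thesis by simp
    qed
    have "inj_on ?Sz riesz_range"
    proof (rule inj_onI)
      fix x y assume xy: "x \<in> riesz_range" "y \<in> riesz_range" "?Sz x = ?Sz y"
      have "x - y = 0"
      proof (rule ker)
        show "x - y \<in> riesz_range" by (rule complex_vector.subspace_diff[OF cN(1) xy(1,2)])
        show "?Sz (x - y) = 0" using xy(3) by (simp only: cblinfun_diff diff_self)
      qed
      then show "x = y" by simp
    qed
    moreover have "y \<in> ?Sz ` riesz_range" if y: "y \<in> riesz_range" for y
    proof -
      define t where "t n = inverse z ^ n *\<^sub>C (cblinfun_apply S ^^ n) y" for n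
      have mem: "t n \<in> riesz_range" for n
        unfolding t_def using funpow_invariant[OF invariant_riesz_range y] complex_vector.subspace_scale[OF cN(1)] by blast
      have "summable (\<lambda>n. K * norm y * (1 / 2 :: real) ^ n)"
        by (intro summable_mult summable_geometric) simp
      then have summ: "summable t"
        by (rule summable_comparison_test'[where N = 0]) (simp only: t_def bound[OF y])
      have tS: "S (t n) = z *\<^sub>C t (Suc n)" for n
        using z by (simp add: t_def cblinfun_apply_scaleC scaleC_scaleC)
      define v where "v = suminf t"
      have v: "v \<in> riesz_range"
        unfolding v_def by (rule suminf_in_closed_subspace[OF csubspace_imp_subspace[OF cN(1)] cN(2) mem summ])
      have "(\<lambda>n. z *\<^sub>C t (Suc n)) sums S v"
        using cblinfun_sums[OF summable_sums[OF summ], of S] unfolding tS v_def .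
      moreover have "(\<lambda>n. z *\<^sub>C t (Suc n)) sums (z *\<^sub>C (v - y))"
      proof (rule bounded_linear.sums[OF scaleC.bounded_linear_right])
        show "(\<lambda>n. t (Suc n)) sums (v - y)"
          using summable_sums[OF summ] by (simp add: sums_Suc_iff v_def) (simp add: t_def)
      qed
      ultimately have "S v = z *\<^sub>C v - z *\<^sub>C y" by (simp add: sums_unique2 flip: scaleC.diff_right)
      then have "?Sz (- inverse z *\<^sub>C v) = y"
        using z by (simp add: shift_op_apply cblinfun_apply_scaleC scaleC_scaleC scaleC.diff_right
            scaleC.minus_left cblinfun_minus)
      moreover have "- inverse z *\<^sub>C v \<in> riesz_range" using v complex_vector.subspace_scale[OF cN(1)] by blast
      ultimately show ?thesis by (metis imageI)
    qed
    ultimately show ?thesis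
      using invariant_closed_subspace_shift[OF invariant_riesz_range, of z]
      unfolding bij_betw_def invariant_closed_subspace_def by blast
  qed
  then show ?thesis
    unfolding quasinilpotent_on_def spectrum_on_def by (auto simp: invertible_on_iff_bij_betw[OF cN])
qed

lemma pseudo_fredholm_isolated: "pseudo_fredholm S"
proof -
  interpret P: bounded_linear riesz_projection by (rule bounded_linear_riesz_projection)
  let ?M = riesz_kernel and ?N = riesz_range
  have sM: "complex_vector.subspace ?M" and sN: "complex_vector.subspace ?N"
    using invariant_riesz_kernel invariant_riesz_range by (simp_all add: invariant_closed_subspace_def)
  have disj: "?M \<inter> ?N = {0}"
    using complex_vector.subspace_0[OF sM] complex_vector.subspace_0[OF sN]
    by (auto simp: riesz_kernel_def riesz_range_def)
  have sum: "\<exists>x\<in>?M. \<exists>y\<in>?N. z = x + y" for z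
  proof (intro bexI)
    show "z = (z - riesz_projection z) + riesz_projection z" by simp
  qed (simp_all add: riesz_kernel_def riesz_range_def P.diff riesz_projection_idem)
  have "semi_regular_on S ?M"
    unfolding semi_regular_on_def
  proof
    have SM: "S ` ?M = ?M" using bij_on_riesz_kernel by (simp add: bij_betw_def)
    then show "closedin (top_of_set ?M) (S ` ?M)" by simp
    have "(cblinfun_apply S ^^ n) ` ?M = ?M" for n
    proof (induction n)
      case (Suc n)
      have "(cblinfun_apply S ^^ Suc n) ` ?M = S ` (cblinfun_apply S ^^ n) ` ?M" by (simp add: image_comp)
      then show ?case by (simp only: Suc SM)
    qed simp
    then show "{x \<in> ?M. S x = 0} \<subseteq> (\<Inter>n. (cblinfun_apply S ^^ n) ` ?M)" by auto
  qed
  with invariant_riesz_kernel invariant_riesz_range disj sum quasinilpotent_on_riesz_range show ?thesis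
    unfolding pseudo_fredholm_def by blast
qed

end

lemma bij_iff_not_in_spectrum:
  "bij (T - z *\<^sub>C id_cblinfun) \<longleftrightarrow> z \<notin> spectrum_on (T :: 'a::complex_banach \<Rightarrow>\<^sub>C\<^sub>L 'a) UNIV"
  by (simp add: spectrum_on_def invertible_on_iff_bij_betw complex_vector.subspace_UNIV)

lemma not_islimpt_imp_pseudo_fredholm:
  fixes T :: "'a::complex_banach \<Rightarrow>\<^sub>C\<^sub>L 'a"
  assumes "\<not> l islimpt spectrum_on T UNIV"
  shows "pseudo_fredholm (T - l *\<^sub>C id_cblinfun)"
proof -
  obtain d where d: "d > 0" "\<And>z. z \<in> spectrum_on T UNIV \<Longrightarrow> z \<noteq> l \<Longrightarrow> dist z l \<ge> d"
    using assms unfolding islimpt_approachable by (metis not_less)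
  have "isolated_spectral_zero (T - l *\<^sub>C id_cblinfun) d"
  proof
    fix z :: complex assume z: "z \<in> ball 0 d - {0}"
    have "l + z \<notin> spectrum_on T UNIV" using d(2)[of "l + z"] z by (auto simp: dist_norm)
    then show "bij (T - l *\<^sub>C id_cblinfun - z *\<^sub>C id_cblinfun)"
      unfolding shift_shift by (simp only: bij_iff_not_in_spectrum not_False_eq_True)
  qed (rule d)
  then show ?thesis by (rule isolated_spectral_zero.pseudo_fredholm_isolated)
qed

text \<open>
This reduces the theorem to a statement about ordinary spectra.
\<close>

lemma gK_spectrum_eq_limit_points:
  fixes T :: "'a::complex_banach \<Rightarrow>\<^sub>C\<^sub>L 'a"
  assumes "SVEP T" "SVEP (adjoint_op T)"
  shows "gK_spectrum T = {z. z islimpt spectrum_on T UNIV}"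
  using pseudo_fredholm_imp_not_islimpt[OF assms] not_islimpt_imp_pseudo_fredholm
  by (auto simp: gK_spectrum_def)

section \<open>Upper triangular operators\<close>

lemma bounded_linear_inl: "bounded_linear (\<lambda>x. (x, 0))" and bounded_linear_inr: "bounded_linear (\<lambda>y. (0, y))"
  by (intro bounded_linear_intros)+

lemma inl_inr_embedding:
  obtains J1 :: "'a::complex_normed_vector \<Rightarrow>\<^sub>C\<^sub>L ('a \<times> 'b::complex_normed_vector)"
    and J2 :: "'b \<Rightarrow>\<^sub>C\<^sub>L ('a \<times> 'b)"
  where "\<And>x. J1 x = (x, 0)" "\<And>y. J2 y = (0, y)"
proof
  have "bounded_clinear (\<lambda>x::'a. (x, 0::'b))" "bounded_clinear (\<lambda>y::'b. (0::'a, y))"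
    by (simp_all add: bounded_clinear_iff scaleC_prod_def scaleC.zero_right bounded_linear_inl bounded_linear_inr)
  then show "CBlinfun (\<lambda>x::'a. (x, 0::'b)) x = (x, 0)" "CBlinfun (\<lambda>y::'b. (0::'a, y)) y = (0, y)" for x y
    by (simp_all add: CBlinfun_inverse)
qed

lemma vector_analytic_on_compose_linear:
  assumes f: "vector_analytic_on f U" and L: "bounded_linear L" and sc: "\<And>c x. L (c *\<^sub>C x) = c *\<^sub>C L x"
  shows "vector_analytic_on (\<lambda>z. L (f z)) U"
  unfolding vector_analytic_on_def
proof
  fix z assume "z \<in> U"
  then obtain d where "(f has_derivative (\<lambda>h. h *\<^sub>C d)) (at z)"
    using f unfolding vector_analytic_on_def by blast
  from bounded_linear.has_derivative[OF L this]
  show "\<exists>d. ((\<lambda>z. L (f z)) has_derivative (\<lambda>h. h *\<^sub>C d)) (at z)" unfolding sc by blast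
qed

lemma SVEP_D:
  fixes T :: "'a::complex_banach \<Rightarrow>\<^sub>C\<^sub>L 'a"
  assumes "SVEP T" "open U" "vector_analytic_on f U" "\<And>z. z \<in> U \<Longrightarrow> T (f z) = z *\<^sub>C f z" "z \<in> U"
  shows "f z = 0"
proof -
  have "\<forall>z\<in>U. (T - z *\<^sub>C id_cblinfun) (f z) = 0" using assms(4) by (simp add: shift_op_apply)
  then show ?thesis using assms(1-3,5) unfolding SVEP_def SVEP_at_def by blast
qed

lemma SVEP_I:
  fixes T :: "'a::complex_banach \<Rightarrow>\<^sub>C\<^sub>L 'a"
  assumes "\<And>U f z. open U \<Longrightarrow> vector_analytic_on f U \<Longrightarrow> (\<And>z. z \<in> U \<Longrightarrow> T (f z) = z *\<^sub>C f z) \<Longrightarrow>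
    z \<in> U \<Longrightarrow> f z = 0"
  shows "SVEP T"
  unfolding SVEP_def SVEP_at_def shift_op_apply
proof (intro allI impI ballI)
  fix z0 z U f
  assume h: "open U \<and> z0 \<in> U \<and> vector_analytic_on f U \<and> (\<forall>z\<in>U. T (f z) - z *\<^sub>C f z = 0)" and "z \<in> U"
  show "f z = 0" by (rule assms[of U f]) (use h \<open>z \<in> U\<close> in auto)
qed

lemma SVEP_upper_triangular:
  fixes A :: "'a::complex_banach \<Rightarrow>\<^sub>C\<^sub>L 'a" and B :: "'b::complex_banach \<Rightarrow>\<^sub>C\<^sub>L 'b"
    and C :: "'b \<Rightarrow>\<^sub>C\<^sub>L 'a"
  assumes "SVEP A" "SVEP B"
  shows "SVEP (upper_triangular_op A C B)"
proof (rule SVEP_I)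
  fix U f z
  assume U: "open U" and f: "vector_analytic_on f U" and z: "z \<in> U"
    and eq: "\<And>z. z \<in> U \<Longrightarrow> upper_triangular_op A C B (f z) = z *\<^sub>C f z"
  have eq': "A (fst (f z)) + C (snd (f z)) = z *\<^sub>C fst (f z)" "B (snd (f z)) = z *\<^sub>C snd (f z)" if "z \<in> U" for z
    using eq[OF that] upper_triangular_op_apply[of A C B "fst (f z)" "snd (f z)"]
    by (simp_all add: scaleC_prod_def)
  have snd0: "snd (f z) = 0" if "z \<in> U" for z
    by (rule SVEP_D[OF assms(2) U vector_analytic_on_compose_linear[OF f bounded_linear_snd] eq'(2) that])
      (simp_all add: scaleC_prod_def)
  have "A (fst (f z)) = z *\<^sub>C fst (f z)" if "z \<in> U" for z
    using eq'(1)[OF that] snd0[OF that] by (simp add: cblinfun_zero)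
  then have "fst (f z) = 0"
    by (intro SVEP_D[OF assms(1) U vector_analytic_on_compose_linear[OF f bounded_linear_fst] _ z])
      (simp_all add: scaleC_prod_def)
  then show "f z = 0" using snd0[OF z] by (simp add: prod_eq_iff)
qed

text \<open>
Restriction to the first summand intertwines the adjoint of the matrix with the adjoint of \<open>A\<close>, so the first component of
an analytic solution vanishes; the second component then solves the equation for the adjoint of \<open>B\<close>.
The restrictions of a functional to the summands are written as adjoints of the embeddings \<open>J1\<close> and \<open>J2\<close>.
\<close>

lemma SVEP_adjoint_upper_triangular:
  fixes A :: "'a::complex_banach \<Rightarrow>\<^sub>C\<^sub>L 'a" and B :: "'b::complex_banach \<Rightarrow>\<^sub>C\<^sub>L 'b"
    and C :: "'b \<Rightarrow>\<^sub>C\<^sub>L 'a"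
  assumes A: "SVEP (adjoint_op A)" and B: "SVEP (adjoint_op B)"
  shows "SVEP (adjoint_op (upper_triangular_op A C B))"
proof (rule SVEP_I)
  let ?M = "upper_triangular_op A C B"
  fix U and f :: "complex \<Rightarrow> ('a \<times> 'b) cdual" and z
  assume U: "open U" and f: "vector_analytic_on f U" and z: "z \<in> U"
    and eq: "\<And>z. z \<in> U \<Longrightarrow> adjoint_op ?M (f z) = z *\<^sub>C f z"
  obtain J1 :: "'a \<Rightarrow>\<^sub>C\<^sub>L ('a \<times> 'b)" and J2 :: "'b \<Rightarrow>\<^sub>C\<^sub>L ('a \<times> 'b)"
    where J: "\<And>x. J1 x = (x, 0)" "\<And>y. J2 y = (0, y)" by (rule inl_inr_embedding) blast
  note analytic = vector_analytic_on_compose_linear[OF f cblinfun_apply_bounded_linear cblinfun_apply_scaleC]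
  have M: "f w (?M v) = w * f w v" if "w \<in> U" for w v
    using arg_cong[OF eq[OF that], of "\<lambda>\<phi>. cblinfun_apply \<phi> v"]
    by (simp add: adjoint_op_apply scaleC_cblinfun.rep_eq scaleC_complex_def)
  have "adjoint_op A (adjoint_op J1 (f w)) = w *\<^sub>C adjoint_op J1 (f w)" if "w \<in> U" for w
  proof (rule cblinfun_eqI)
    fix x
    show "adjoint_op A (adjoint_op J1 (f w)) x = (w *\<^sub>C adjoint_op J1 (f w)) x"
      using M[OF that, of "(x, 0)"]
      by (simp add: adjoint_op_apply scaleC_cblinfun.rep_eq scaleC_complex_def J upper_triangular_op_apply cblinfun_zero)
  qed
  then have fst0: "adjoint_op J1 (f w) = 0" if "w \<in> U" for w
    by (rule SVEP_D[OF A U analytic _ that])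
  have f1: "f w (x, 0) = 0" if "w \<in> U" for w x
    using arg_cong[OF fst0[OF that], of "\<lambda>\<phi>. cblinfun_apply \<phi> x"] 
    by (simp add: adjoint_op_apply J zero_cblinfun.rep_eq)
  have split: "f w (x, y) = f w (0, y)" if "w \<in> U" for w x y
    using cblinfun_add[of "f w" "(x, 0)" "(0, y)"] f1[OF that, of x] by simp
  have "adjoint_op B (adjoint_op J2 (f w)) = w *\<^sub>C adjoint_op J2 (f w)" if "w \<in> U" for w
  proof (rule cblinfun_eqI)
    fix y
    show "adjoint_op B (adjoint_op J2 (f w)) y = (w *\<^sub>C adjoint_op J2 (f w)) y"
      using M[OF that, of "(0, y)"] split[OF that, of "C y" "B y"]
      by (simp add: adjoint_op_apply scaleC_cblinfun.rep_eq scaleC_complex_def J upper_triangular_op_apply cblinfun_zero)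
  qed
  then have snd0: "adjoint_op J2 (f z) = 0"
    by (rule SVEP_D[OF B U analytic _ z])
  have f2: "f z (0, y) = 0" for y
    using arg_cong[OF snd0, of "\<lambda>\<phi>. cblinfun_apply \<phi> y"]
    by (simp add: adjoint_op_apply J zero_cblinfun.rep_eq)
  show "f z = 0"
  proof (rule cblinfun_eqI)
    fix v show "f z v = (0 :: ('a \<times> 'b) cdual) v"
      using split[OF z, of "fst v" "snd v"] f2[of "snd v"] by (simp add: zero_cblinfun.rep_eq)
  qed
qed

text \<open>
A surjective operator is semi-regular, so its injectivity is a case of the lemma for semi-regular summands.
\<close>

lemma surj_SVEP_imp_bij:
  fixes T :: "'a::complex_banach \<Rightarrow>\<^sub>C\<^sub>L 'a"
  assumes "SVEP T" and s: "surj (T - z *\<^sub>C id_cblinfun)"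
  shows "bij (T - z *\<^sub>C id_cblinfun)"
proof (rule bijI[OF injI s])
  let ?S = "T - z *\<^sub>C id_cblinfun"
  fix x y assume "?S x = ?S y"
  then have "?S (x - y) = 0" by (simp only: cblinfun_diff diff_self)
  moreover have "semi_regular_on ?S UNIV" 
    unfolding semi_regular_on_def using s surj_fn[OF s] by auto
  moreover have "invariant_closed_subspace ?S UNIV"
    by (simp add: invariant_closed_subspace_def complex_vector.subspace_UNIV)
  ultimately have "x - y = 0" using semi_regular_SVEP_inj[OF assms(1), of z UNIV] by blast
  then show "x = y" by simp
qed

text \<open>
If the matrix is invertible, \<open>B - z\<close> is onto, hence injective by the extension property of \<open>B\<close>. A preimage of
\<open>(x, 0)\<close> then has second component zero, which makes \<open>A - z\<close> onto as well.
\<close>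

lemma spectrum_upper_triangular:
  fixes A :: "'a::complex_banach \<Rightarrow>\<^sub>C\<^sub>L 'a" and B :: "'b::complex_banach \<Rightarrow>\<^sub>C\<^sub>L 'b"
    and C :: "'b \<Rightarrow>\<^sub>C\<^sub>L 'a"
  assumes "SVEP B"
  shows "spectrum_on (upper_triangular_op A C B) UNIV = spectrum_on A UNIV \<union> spectrum_on B UNIV"
proof -
  let ?M = "upper_triangular_op A C B"
  have "bij (?M - z *\<^sub>C id_cblinfun) \<longleftrightarrow> bij (A - z *\<^sub>C id_cblinfun) \<and> bij (B - z *\<^sub>C id_cblinfun)" for z
  proof -
    let ?A = "A - z *\<^sub>C id_cblinfun" and ?B = "B - z *\<^sub>C id_cblinfun" and ?Mz = "?M - z *\<^sub>C id_cblinfun"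
    have M: "?Mz (x, y) = (?A x + C y, ?B y)" for x y
      by (simp add: shift_op_apply upper_triangular_op_apply scaleC_prod_def)
    show ?thesis
    proof
      assume bij: "bij ?Mz"
      have "surj ?B"
      proof (rule surjI)
        fix y
        obtain u v where "?Mz (u, v) = (0, y)" using bij_is_surj[OF bij] by (metis surjD surj_pair)
        then have "\<exists>v. ?B v = y" unfolding M by blast
        then show "?B (SOME v. ?B v = y) = y" by (rule someI_ex)
      qed
      then have B: "bij ?B" by (rule surj_SVEP_imp_bij[OF assms])
      have "inj ?A"
      proof (rule injI)
        fix x y assume "?A x = ?A y"
        then have "?Mz (x, 0) = ?Mz (y, 0)" unfolding M by simp
        then show "x = y" using bij_is_inj[OF bij] by (metis injD Pair_inject)
      qed
      moreover have "\<exists>u. ?A u = x" for x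
      proof -
        obtain u v where "?Mz (u, v) = (x, 0)" using bij_is_surj[OF bij] by (metis surjD surj_pair)
        then have uv: "?A u + C v = x" "?B v = 0" unfolding M by auto
        have "?B v = ?B 0" by (simp only: uv(2) cblinfun_zero)
        then have "v = 0" using bij_is_inj[OF B] by (meson injD)
        then show ?thesis using uv(1) by (auto simp only: cblinfun_zero add_0_right)
      qed
      ultimately have "bij ?A" by (metis bijI surj_def)
      with B show "bij ?A \<and> bij ?B" by blast
    next
      assume "bij ?A \<and> bij ?B"
      then have A: "bij ?A" and B: "bij ?B" by auto
      show "bij ?Mz"
      proof (rule bijI)
        show "inj ?Mz"
        proof (rule injI)
          fix p q assume eq: "?Mz p = ?Mz q"
          obtain x y u v where pq: "p = (x, y)" "q = (u, v)" by fastforce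
          then have e: "?A x + C y = ?A u + C v" "?B y = ?B v" using eq unfolding pq M by auto
          then have "y = v" using bij_is_inj[OF B] by (meson injD)
          moreover from this e have "?A x = ?A u" by simp
          then have "x = u" using bij_is_inj[OF A] by (meson injD)
          ultimately show "p = q" using pq by simp
        qed
        have "\<exists>p. q = ?Mz p" for q
        proof -
          obtain v where v: "?B v = snd q" using bij_is_surj[OF B] by (metis surjD)
          obtain u where u: "?A u = fst q - C v" using bij_is_surj[OF A] by (metis surjD)
          have "?Mz (u, v) = q" unfolding M u v by simp
          then show ?thesis by metis
        qed
        then show "surj ?Mz" by (auto simp only: surj_def)
      qed
    qed
  qed
  then show ?thesis unfolding bij_iff_not_in_spectrum by blast
qed

theorem theorem4p1:
  fixes A :: "'a::complex_banach \<Rightarrow>\<^sub>C\<^sub>L 'a" and B :: "'b::complex_banach \<Rightarrow>\<^sub>C\<^sub>L 'b"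
  assumes "SVEP A" and "SVEP (adjoint_op A)" and "SVEP B" and "SVEP (adjoint_op B)"
  shows "\<forall>C :: 'b \<Rightarrow>\<^sub>C\<^sub>L 'a.
    gK_spectrum (upper_triangular_op A C B) = gK_spectrum A \<union> gK_spectrum B"
proof
  fix C :: "'b \<Rightarrow>\<^sub>C\<^sub>L 'a"
  have M: "SVEP (upper_triangular_op A C B)" "SVEP (adjoint_op (upper_triangular_op A C B))"
    using assms by (auto intro: SVEP_upper_triangular SVEP_adjoint_upper_triangular)
  show "gK_spectrum (upper_triangular_op A C B) = gK_spectrum A \<union> gK_spectrum B"
    unfolding gK_spectrum_eq_limit_points[OF M] gK_spectrum_eq_limit_points[OF assms(1,2)]
      gK_spectrum_eq_limit_points[OF assms(3,4)] spectrum_upper_triangular[OF assms(3)] islimpt_Un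
    by blast
qed

end
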